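(* Let $\rho$ be a quantum state (density operator) on a complex separable Hilbert space $\mathcal{H}$ that is not maximally mixed, and let $\lambda_{\min}$ and $\lambda_{\max}$ denote the smallest and largest eigenvalues of $\rho$. Then for all observables $A$ and $B$ on $\mathcal{H}$, $$V_\rho(A)\,V_\rho(B)\ \ge\ \frac{(\lambda_{\max}+\lambda_{\min})^2}{4(\lambda_{\max}-\lambda_{\min})^2}\,\bigl|\langle [A,B]\rangle_\rho\bigr|^2+\mathrm{Cov}_\rho(A,B)^2 .$$
   Context: A quantum state (density operator) $\rho$ on $\mathcal{H}$ is a positive semidefinite trace-class operator with $\operatorname{Tr}\rho=1$. An observable is a (bounded) Hermitian operator on $\mathcal{H}$; if $\dim\mathcal{H}=d<\infty$ this is a $d\times d$ Hermitian matrix. For an operator $X$: $\langle X\rangle_\rho:=\operatorname{Tr}[X\rho]$ is the expectation value; for Hermitian $X$, $V_\rho(X):=\operatorname{Tr}[(X-\langle X\rangle_\rho \mathbb{I})^2\rho]$ is the variance. $[A,B]:=AB-BA$, $\{A,B\}:=AB+BA$, and $\mathrm{Cov}_\rho(A,B):=\tfrac12\langle\{A,B\}\rangle_\rho-\langle A\rangle_\rho\langle B\rangle_\rho$ is the quantum covariance. The maximally mixed state on a $d$-dimensional space is $\mathbb{I}/d$; it is the only state with $\lambda_{\max}=\lambda_{\min}$. If $\mathcal{H}$ is infinite-dimensional, $\lambda_{\min}$ is understood as the infimum of the spectrum of $\rho$, so $\lambda_{\min}=0$. *)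

theory Defs
  imports "HOL-Analysis.Analysis"
begin

section \<open>Complex Hilbert spaces\<close>

text \<open>
  The norm and topology are those of the underlying real inner product \<open>Re (cinner x y)\<close>.
  The inner product is linear in its second argument.
\<close>

class complex_inner = real_inner +
  fixes scaleC :: "complex \<Rightarrow> 'a \<Rightarrow> 'a" (infixr "*\<^sub>C" 75)
    and cinner :: "'a \<Rightarrow> 'a \<Rightarrow> complex"
  assumes scaleC_add_right: "a *\<^sub>C (x + y) = a *\<^sub>C x + a *\<^sub>C y"
    and scaleC_add_left: "(a + b) *\<^sub>C x = a *\<^sub>C x + b *\<^sub>C x"
    and scaleC_scaleC: "a *\<^sub>C b *\<^sub>C x = (a * b) *\<^sub>C x"
    and scaleC_one: "1 *\<^sub>C x = x"
    and scaleR_scaleC: "scaleR r x = complex_of_real r *\<^sub>C x"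
    and cinner_commute: "cinner x y = cnj (cinner y x)"
    and cinner_add_right: "cinner x (y + z) = cinner x y + cinner x z"
    and cinner_scaleC_right: "cinner x (a *\<^sub>C y) = a * cinner x y"
    and inner_eq_Re_cinner: "inner x y = Re (cinner x y)"

class chilbert_space = complex_inner + complete_space

global_interpretation complex_vector: vector_space "scaleC :: complex \<Rightarrow> 'a \<Rightarrow> 'a::complex_inner"
  by unfold_locales
    (simp_all add: scaleC_add_right scaleC_add_left scaleC_scaleC scaleC_one)

instantiation complex :: chilbert_space
begin

definition scaleC_complex_def: "scaleC a (x :: complex) = a * x"

definition cinner_complex_def: "cinner (x :: complex) y = cnj x * y"

instance
  by intro_classes
    (simp_all add: scaleC_complex_def cinner_complex_def algebra_simps scaleR_conv_of_real
      inner_complex_def)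

end

definition finite_dimensional :: "'a::complex_inner itself \<Rightarrow> bool" where
  "finite_dimensional _ \<longleftrightarrow> (\<exists>B :: 'a set. finite B \<and> complex_vector.span B = UNIV)"

definition orthonormal :: "'a::complex_inner set \<Rightarrow> bool" where
  "orthonormal E \<longleftrightarrow> (\<forall>e\<in>E. \<forall>f\<in>E. cinner e f = (if e = f then 1 else 0))"

text \<open>An orthonormal basis is a maximal orthonormal set.\<close>

definition is_onb :: "'a::complex_inner set \<Rightarrow> bool" where
  "is_onb E \<longleftrightarrow> orthonormal E \<and> (\<forall>x. (\<forall>e\<in>E. cinner e x = 0) \<longrightarrow> x = 0)"

lemma ex_is_onb: "\<exists>E :: 'a::complex_inner set. is_onb E"
proof -
  have "\<exists>M\<in>Collect orthonormal. \<forall>X\<in>Collect orthonormal. M \<subseteq> X \<longrightarrow> X = (M :: 'a set)"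
  proof (rule subset_Zorn')
    fix C :: "'a set set"
    assume C: "subset.chain (Collect orthonormal) C"
    have "cinner e f = (if e = f then 1 else 0)" if "e \<in> \<Union>C" "f \<in> \<Union>C" for e f
    proof -
      from that obtain X Y where XY: "X \<in> C" "e \<in> X" "Y \<in> C" "f \<in> Y" by blast
      have "X \<subseteq> Y \<or> Y \<subseteq> X" using C XY by (auto simp: subset_chain_def)
      then obtain Z where "Z \<in> C" "e \<in> Z" "f \<in> Z" using XY by blast
      moreover have "orthonormal Z" using C \<open>Z \<in> C\<close> by (auto simp: subset_chain_def)
      ultimately show ?thesis by (auto simp: orthonormal_def)
    qed
    then show "\<Union>C \<in> Collect orthonormal" by (simp add: orthonormal_def)
  qed
  then obtain M :: "'a set" where M: "orthonormal M"
    and max: "\<And>X. orthonormal X \<Longrightarrow> M \<subseteq> X \<Longrightarrow> X = M" by blast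
  have "x = 0" if x: "\<forall>e\<in>M. cinner e x = 0" for x
  proof (rule ccontr)
    assume "x \<noteq> 0"
    define u where "u = complex_of_real (inverse (norm x)) *\<^sub>C x"
    have u: "u = sgn x" by (simp add: u_def sgn_div_norm scaleR_scaleC)
    have "Re (cinner u u) = 1"
      using \<open>x \<noteq> 0\<close> by (simp flip: inner_eq_Re_cinner add: u dot_square_norm norm_sgn)
    moreover have "Im (cinner u u) = 0"
      using arg_cong[OF cinner_commute[of u u], of Im] by simp
    ultimately have uu: "cinner u u = 1" by (simp add: complex_eq_iff)
    have eu: "cinner e u = 0" if "e \<in> M" for e
      using x that by (simp add: u_def cinner_scaleC_right)
    have ue: "cinner u e = 0" if "e \<in> M" for e
      using eu[OF that] cinner_commute[of u e] by simp
    have "orthonormal (insert u M)"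
      using M uu eu ue by (auto simp: orthonormal_def)
    then have "u \<in> M" using max by blast
    then show False using eu uu by fastforce
  qed
  then show ?thesis using M unfolding is_onb_def by blast
qed

section \<open>Operators\<close>

definition bounded_clinear :: "('a::complex_inner \<Rightarrow> 'a) \<Rightarrow> bool" where
  "bounded_clinear T \<longleftrightarrow> bounded_linear T \<and> (\<forall>c x. T (c *\<^sub>C x) = c *\<^sub>C T x)"

definition observable :: "('a::complex_inner \<Rightarrow> 'a) \<Rightarrow> bool" where
  "observable A \<longleftrightarrow> bounded_clinear A \<and> (\<forall>x y. cinner (A x) y = cinner x (A y))"

definition positive_op :: "('a::complex_inner \<Rightarrow> 'a) \<Rightarrow> bool" where
  "positive_op T \<longleftrightarrow> bounded_clinear T \<and> (\<forall>x. cinner x (T x) \<in> nonneg_Reals)"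

text \<open>
  The operator \<open>P\<close> below is \<open>|T| = sqrt (T* T)\<close>: since \<open>P\<close> is positive, hence self-adjoint,
  the identity \<open>cinner (P x) (P y) = cinner (T x) (T y)\<close> says that \<open>P P = T* T\<close>.
\<close>

definition trace_class :: "('a::complex_inner \<Rightarrow> 'a) \<Rightarrow> bool" where
  "trace_class T \<longleftrightarrow> bounded_clinear T \<and>
    (\<exists>P E. positive_op P \<and> (\<forall>x y. cinner (P x) (P y) = cinner (T x) (T y)) \<and>
      is_onb E \<and> (\<lambda>e. cinner e (P e)) summable_on E)"

text \<open>For trace-class \<open>T\<close> on a Hilbert space the value does not depend on the basis chosen.\<close>

definition trace_op :: "('a::complex_inner \<Rightarrow> 'a) \<Rightarrow> complex" where
  "trace_op T = infsum (\<lambda>e. cinner e (T e)) (SOME E. is_onb E)"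

definition eigenvalue :: "('a::complex_inner \<Rightarrow> 'a) \<Rightarrow> complex \<Rightarrow> bool" where
  "eigenvalue T c \<longleftrightarrow> (\<exists>v. v \<noteq> 0 \<and> T v = c *\<^sub>C v)"

definition op_spectrum :: "('a::complex_inner \<Rightarrow> 'a) \<Rightarrow> complex set" where
  "op_spectrum T = {c. \<not> (\<exists>S. bounded_clinear S \<and>
    (\<forall>x. S (T x - c *\<^sub>C x) = x) \<and> (\<forall>x. T (S x) - c *\<^sub>C S x = x))}"

section \<open>Quantum states\<close>

definition quantum_state :: "('a::complex_inner \<Rightarrow> 'a) \<Rightarrow> bool" where
  "quantum_state \<rho> \<longleftrightarrow> positive_op \<rho> \<and> trace_class \<rho> \<and> trace_op \<rho> = 1"

definition maximally_mixed :: "('a::complex_inner \<Rightarrow> 'a) \<Rightarrow> bool" where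
  "maximally_mixed \<rho> \<longleftrightarrow> finite_dimensional TYPE('a) \<and>
    \<rho> = (\<lambda>x. (1 / of_nat (complex_vector.dim (UNIV :: 'a set))) *\<^sub>C x)"

text \<open>The eigenvalues and the spectrum of a positive operator are real.\<close>

definition lambda_max :: "('a::complex_inner \<Rightarrow> 'a) \<Rightarrow> real" where
  "lambda_max \<rho> = (GREATEST l. eigenvalue \<rho> (complex_of_real l))"

definition lambda_min :: "('a::complex_inner \<Rightarrow> 'a) \<Rightarrow> real" where
  "lambda_min \<rho> = (if finite_dimensional TYPE('a)
    then (LEAST l. eigenvalue \<rho> (complex_of_real l))
    else Inf {l. complex_of_real l \<in> op_spectrum \<rho>})"

definition expectation :: "('a::complex_inner \<Rightarrow> 'a) \<Rightarrow> ('a \<Rightarrow> 'a) \<Rightarrow> complex" where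
  "expectation \<rho> X = trace_op (X \<circ> \<rho>)"

definition commutator :: "('a::complex_inner \<Rightarrow> 'a) \<Rightarrow> ('a \<Rightarrow> 'a) \<Rightarrow> 'a \<Rightarrow> 'a" where
  "commutator A B = (\<lambda>x. A (B x) - B (A x))"

definition anticommutator :: "('a::complex_inner \<Rightarrow> 'a) \<Rightarrow> ('a \<Rightarrow> 'a) \<Rightarrow> 'a \<Rightarrow> 'a" where
  "anticommutator A B = (\<lambda>x. A (B x) + B (A x))"

text \<open>
  For a state and observables the complex numbers under \<open>Re\<close> in the next two definitions are
  real, so \<open>Re\<close> only serves to land in type \<open>real\<close>.
\<close>

definition variance :: "('a::complex_inner \<Rightarrow> 'a) \<Rightarrow> ('a \<Rightarrow> 'a) \<Rightarrow> real" where
  "variance \<rho> X =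
    (let Y = (\<lambda>x. X x - expectation \<rho> X *\<^sub>C x) in Re (expectation \<rho> (Y \<circ> Y)))"

definition covariance :: "('a::complex_inner \<Rightarrow> 'a) \<Rightarrow> ('a \<Rightarrow> 'a) \<Rightarrow> ('a \<Rightarrow> 'a) \<Rightarrow> real" where
  "covariance \<rho> A B =
    Re (1 / 2 * expectation \<rho> (anticommutator A B) - expectation \<rho> A * expectation \<rho> B)"

end

theory Submission
  imports Defs
begin

text \<open>
  A positive trace-class operator is compact and hence diagonal in an orthonormal basis \<open>F\<close>,
  \<open>\<rho> f = \<mu> f f\<close>, so that the expectation of \<open>Y\<close> is the absolutely convergent sum of
  \<open>\<mu> f \<langle>f, Y f\<rangle>\<close>. With \<open>r = (\<lambda>_max + \<lambda>_min) / (\<lambda>_max - \<lambda>_min)\<close>, the sesquilinear form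
  \<open>h(X, Y) = (1 + r)/2 \<langle>X* Y\<rangle> + (1 - r)/2 \<langle>Y X*\<rangle>\<close> is positive semidefinite: if \<open>F\<close> is finite,
  then \<open>h(X, X)\<close> is a positive multiple of
  \<open>\<lambda>_max \<langle>X* X\<rangle> - \<lambda>_min \<langle>X X*\<rangle> \<ge> \<lambda>_max \<lambda>_min (Tr X* X - Tr X X*) = 0\<close>; if \<open>F\<close> is infinite, then
  \<open>\<lambda>_min = 0\<close> and \<open>r = 1\<close>. (When \<open>\<lambda>_max = \<lambda>_min\<close>, division by zero makes \<open>r = 0\<close>.)
  For the centred observables \<open>A\<close>, \<open>B\<close> the diagonal values of \<open>h\<close> are the variances and
  \<open>h(A, B) = Cov(A, B) + r/2 \<langle>[A, B]\<rangle>\<close>, whose second summand is imaginary, so the claim is the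
  Cauchy--Schwarz inequality for \<open>h\<close>.
\<close>

section \<open>Orthonormal bases\<close>

lemma cinner_add_left: "cinner (x + y) z = cinner x z + cinner y (z::'a::complex_inner)"
  by (metis cinner_add_right cinner_commute complex_cnj_add)

lemma cinner_scaleC_left: "cinner (a *\<^sub>C x) y = cnj a * cinner x (y::'a::complex_inner)"
  by (metis cinner_scaleC_right cinner_commute complex_cnj_mult)

lemma scaleC_minus1: "(-1) *\<^sub>C x = - (x::'a::complex_inner)"
  using scaleR_scaleC[of "-1" x] by simp

lemma cinner_minus_right: "cinner x (- y) = - cinner x (y::'a::complex_inner)"
  using cinner_scaleC_right[of x "-1" y] by (simp add: scaleC_minus1)

lemma cinner_minus_left: "cinner (- x) y = - cinner x (y::'a::complex_inner)"
  using cinner_scaleC_left[of "-1" x y] by (simp add: scaleC_minus1)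

lemma cinner_diff_right: "cinner x (y - z) = cinner x y - cinner x (z::'a::complex_inner)"
  using cinner_add_right[of x y "- z"] by (simp add: cinner_minus_right)

lemma cinner_diff_left: "cinner (x - y) z = cinner x z - cinner y (z::'a::complex_inner)"
  using cinner_add_left[of x "- y" z] by (simp add: cinner_minus_left)

lemma cinner_zero_right [simp]: "cinner x (0::'a::complex_inner) = 0"
  using cinner_add_right[of x 0 0] by simp

lemma cinner_sum_right: "cinner x (sum f I) = (\<Sum>i\<in>I. cinner x (f i :: 'a::complex_inner))"
  by (induction I rule: infinite_finite_induct) (simp_all add: cinner_add_right)

lemma cinner_self: "cinner x x = complex_of_real ((norm (x::'a::complex_inner))\<^sup>2)"
proof -
  have "Re (cinner x x) = (norm x)\<^sup>2"
    by (simp flip: inner_eq_Re_cinner add: dot_square_norm)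
  moreover have "Im (cinner x x) = 0"
    using arg_cong[OF cinner_commute[of x x], of Im] by simp
  ultimately show ?thesis by (simp add: complex_eq_iff)
qed

lemma norm_scaleC: "norm (a *\<^sub>C x) = cmod a * norm (x::'a::complex_inner)"
proof -
  have "cinner (a *\<^sub>C x) (a *\<^sub>C x) = (a * cnj a) * cinner x x"
    by (simp add: cinner_scaleC_left cinner_scaleC_right)
  then have "complex_of_real ((norm (a *\<^sub>C x))\<^sup>2) = complex_of_real ((cmod a)\<^sup>2 * (norm x)\<^sup>2)"
    unfolding cinner_self complex_norm_square[symmetric] of_real_mult .
  then have "(norm (a *\<^sub>C x))\<^sup>2 = (cmod a * norm x)\<^sup>2"
    unfolding of_real_eq_iff power_mult_distrib .
  then show ?thesis by (rule power2_eq_imp_eq) simp_all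
qed

text \<open>Scaling \<open>x\<close> by \<open>c = cinner x y\<close> makes the pairing with
  \<open>y\<close> real, equal to the squared modulus of \<open>c\<close>, so the real
  Cauchy-Schwarz inequality applies.\<close>

lemma cmod_cinner_le: "cmod (cinner x y) \<le> norm x * norm (y::'a::complex_inner)"
proof -
  define c where "c = cinner x y"
  have "(cmod c)\<^sup>2 = Re (cinner (c *\<^sub>C x) y)"
    unfolding cinner_scaleC_left c_def[symmetric] cmod_power2 by (simp add: power2_eq_square)
  also have "\<dots> = inner (c *\<^sub>C x) y" by (simp add: inner_eq_Re_cinner)
  also have "\<dots> \<le> cmod c * (norm x * norm y)"
    using norm_cauchy_schwarz[of "c *\<^sub>C x" y] by (simp add: norm_scaleC mult.assoc)
  finally show ?thesis unfolding c_def[symmetric]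
    by (cases "c = 0") (simp_all add: power2_eq_square)
qed

lemma bounded_linear_cinner_right: "bounded_linear (cinner (x::'a::complex_inner))"
proof (rule bounded_linear_intro)
  show "cinner x (y + z) = cinner x y + cinner x z" for y z by (rule cinner_add_right)
  show "cinner x (r *\<^sub>R y) = r *\<^sub>R cinner x y" for r y
    by (simp add: cinner_scaleC_right scaleR_conv_of_real scaleR_scaleC[where 'a='a])
  show "cmod (cinner x y) \<le> norm y * norm x" for y
    using cmod_cinner_le[of x y] by (simp add: mult.commute)
qed

lemma bounded_linear_scaleC: "bounded_linear (\<lambda>x::'a::complex_inner. c *\<^sub>C x)"
  by (rule bounded_linear_intro[of _ "cmod c"])
    (simp_all add: scaleC_add_right scaleR_scaleC scaleC_scaleC norm_scaleC mult.commute)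

lemma continuous_scaleC_left: "continuous_on UNIV (\<lambda>c. c *\<^sub>C (x::'a::complex_inner))"
proof -
  have "bounded_linear (\<lambda>c. c *\<^sub>C x)"
    by (rule bounded_linear_intro[of _ "norm x"])
      (simp_all add: scaleC_add_left scaleR_scaleC[where 'a='a] scaleC_scaleC norm_scaleC scaleR_conv_of_real)
  then show ?thesis by (rule linear_continuous_on)
qed

section \<open>Orthonormal sums, unordered summation and expansion in a basis\<close>

lemma norm_orthonormal:
  assumes "orthonormal E" "e \<in> E"
  shows "norm e = 1"
proof -
  have "cinner e e = 1" using assms by (simp add: orthonormal_def)
  then have "(norm e)\<^sup>2 = 1" by (metis cinner_self of_real_eq_1_iff)
  then have "(norm e)\<^sup>2 = 1\<^sup>2" by simp
  then show ?thesis by (rule power2_eq_imp_eq) simp_all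
qed

lemma norm_sum_orthonormal:
  assumes "orthonormal E" "finite F" "F \<subseteq> E"
  shows "(norm (\<Sum>e\<in>F. c e *\<^sub>C e))\<^sup>2 = (\<Sum>e\<in>F. (cmod (c e))\<^sup>2)"
proof -
  let ?s = "\<Sum>e\<in>F. c e *\<^sub>C e"
  have co: "cinner e ?s = c e" if "e \<in> F" for e
  proof -
    have "c f * cinner e f = (if f = e then c f else 0)" if "f \<in> F" for f
      using assms that \<open>e \<in> F\<close> by (auto simp: orthonormal_def subset_eq)
    then have "cinner e ?s = (\<Sum>f\<in>F. if f = e then c f else 0)"
      by (simp add: cinner_sum_right cinner_scaleC_right)
    then show ?thesis using assms that by simp
  qed
  have "cinner ?s ?s = (\<Sum>e\<in>F. c e * cinner ?s e)"
    by (simp only: cinner_sum_right[of ?s] cinner_scaleC_right)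
  also have "\<dots> = (\<Sum>e\<in>F. cnj (cinner e ?s) * c e)"
    by (intro sum.cong refl) (subst cinner_commute, rule mult.commute)
  also have "\<dots> = (\<Sum>e\<in>F. complex_of_real ((cmod (c e))\<^sup>2))"
    by (intro sum.cong refl) (simp only: co complex_norm_square mult.commute)
  finally have "complex_of_real ((norm ?s)\<^sup>2) = complex_of_real (\<Sum>e\<in>F. (cmod (c e))\<^sup>2)"
    by (simp add: cinner_self)
  then show ?thesis by (metis of_real_eq_iff)
qed

text \<open>The squared distance from \<open>x\<close> to its projection on the span of
  \<open>F\<close> equals the right side minus the left side.\<close>

lemma Bessel_finite:
  assumes "orthonormal E" "finite F" "F \<subseteq> E"
  shows "(\<Sum>e\<in>F. (cmod (cinner e x))\<^sup>2) \<le> (norm x)\<^sup>2"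
proof -
  let ?s = "\<Sum>e\<in>F. cinner e x *\<^sub>C e"
  have "cinner x ?s = (\<Sum>e\<in>F. complex_of_real ((cmod (cinner e x))\<^sup>2))"
    unfolding cinner_sum_right cinner_scaleC_right
    by (intro sum.cong refl) (subst (2) cinner_commute, rule complex_norm_square[symmetric])
  then have "inner x ?s = (\<Sum>e\<in>F. (cmod (cinner e x))\<^sup>2)"
    by (simp add: inner_eq_Re_cinner)
  moreover have "(norm (x - ?s))\<^sup>2 = (norm x)\<^sup>2 - 2 * inner x ?s + (norm ?s)\<^sup>2"
    by (simp add: power2_norm_eq_inner inner_diff_left inner_diff_right inner_commute)
  ultimately have "(norm (x - ?s))\<^sup>2 = (norm x)\<^sup>2 - (\<Sum>e\<in>F. (cmod (cinner e x))\<^sup>2)"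
    by (simp add: norm_sum_orthonormal[OF assms])
  moreover have "0 \<le> (norm (x - ?s))\<^sup>2" by simp
  ultimately show ?thesis by linarith
qed

lemma Bessel_summable:
  assumes "orthonormal E"
  shows "(\<lambda>e. (cmod (cinner e x))\<^sup>2) summable_on E"
  by (rule nonneg_bounded_partial_sums_imp_summable_on[of _ _ "(norm x)\<^sup>2"])
    (auto intro!: eventually_finite_subsets_at_top_weakI Bessel_finite[OF assms])

lemma summable_on_small_tails:
  fixes g :: "'b \<Rightarrow> real"
  assumes "g summable_on A" "\<epsilon> > 0"
  obtains F where "finite F" "F \<subseteq> A"
    "\<And>G. finite G \<Longrightarrow> G \<subseteq> A \<Longrightarrow> G \<inter> F = {} \<Longrightarrow> \<bar>sum g G\<bar> < \<epsilon>"
proof -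
  from assms(1) obtain S where "(g has_sum S) A" by (auto simp: summable_on_def)
  then have "\<forall>\<^sub>F F in finite_subsets_at_top A. dist (sum g F) S < \<epsilon> / 2"
    unfolding has_sum_def by (rule tendstoD) (use assms in simp)
  then obtain F where F: "finite F" "F \<subseteq> A"
    and close: "\<And>Y. finite Y \<Longrightarrow> F \<subseteq> Y \<Longrightarrow> Y \<subseteq> A \<Longrightarrow> dist (sum g Y) S < \<epsilon> / 2"
    by (auto simp: eventually_finite_subsets_at_top)
  show ?thesis
  proof (rule that[OF F])
    fix G assume G: "finite G" "G \<subseteq> A" "G \<inter> F = {}"
    have "dist (sum g (F \<union> G)) S < \<epsilon> / 2" "dist (sum g F) S < \<epsilon> / 2"
      using F G by (intro close; auto)+
    moreover have "sum g (F \<union> G) = sum g F + sum g G"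
      using F G by (subst sum.union_disjoint) auto
    ultimately show "\<bar>sum g G\<bar> < \<epsilon>" unfolding dist_real_def by linarith
  qed
qed

text \<open>The converse of the previous tail estimate, with values in a complete space: small tails
  make the net of finite partial sums a Cauchy filter.\<close>

lemma summable_on_Cauchy:
  fixes g :: "'b \<Rightarrow> 'a::{real_normed_vector, complete_space}"
  assumes "\<And>\<epsilon>. \<epsilon> > 0 \<Longrightarrow> \<exists>F. finite F \<and> F \<subseteq> A \<and>
    (\<forall>G. finite G \<longrightarrow> G \<subseteq> A \<longrightarrow> G \<inter> F = {} \<longrightarrow> norm (sum g G) < \<epsilon>)"
  shows "g summable_on A"
proof -
  have "\<exists>P. eventually P (finite_subsets_at_top A) \<and>
      (\<forall>X Y. P X \<and> P Y \<longrightarrow> dist (sum g X) (sum g Y) < e)" if "e > 0" for e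
  proof -
    from that have "e / 2 > 0" by simp
    from assms[OF this] obtain F where "finite F \<and> F \<subseteq> A \<and>
      (\<forall>G. finite G \<longrightarrow> G \<subseteq> A \<longrightarrow> G \<inter> F = {} \<longrightarrow> norm (sum g G) < e / 2)" ..
    then have F: "finite F" "F \<subseteq> A"
      "\<And>G. finite G \<Longrightarrow> G \<subseteq> A \<Longrightarrow> G \<inter> F = {} \<Longrightarrow> norm (sum g G) < e / 2"
      by blast+
    let ?P = "\<lambda>X. finite X \<and> F \<subseteq> X \<and> X \<subseteq> A"
    have near: "dist (sum g X) (sum g F) < e / 2" if "?P X" for X
    proof -
      have "sum g X - sum g F = sum g (X - F)"
        using that F by (simp add: sum_diff)
      then show ?thesis using F(3)[of "X - F"] that by (auto simp: dist_norm)
    qed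
    have "dist (sum g X) (sum g Y) < e" if "?P X" "?P Y" for X Y
      using near[OF that(1)] near[OF that(2)] by (metis dist_triangle_half_l)
    moreover have "eventually ?P (finite_subsets_at_top A)"
      using F by (auto simp: eventually_finite_subsets_at_top)
    ultimately show ?thesis by (intro exI[of _ ?P] conjI allI impI) simp_all
  qed
  then have "cauchy_filter (filtermap (sum g) (finite_subsets_at_top A))"
    by (simp add: cauchy_filter_metric_filtermap)
  moreover have "complete (UNIV :: 'a set)" by (rule complete_UNIV)
  ultimately obtain L where "(sum g \<longlongrightarrow> L) (finite_subsets_at_top A)"
    using cauchy_filter_complete_converges[of "filtermap (sum g) (finite_subsets_at_top A)" UNIV]
    by (auto simp: filterlim_def filtermap_bot_iff)
  then show ?thesis by (auto simp: summable_on_def has_sum_def)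
qed

text \<open>Bessel's inequality makes the partial sums Cauchy. Their limit has the same coefficients
  as \<open>x\<close>, and maximality of \<open>E\<close> then identifies the two.\<close>

lemma has_sum_onb:
  fixes x :: "'a::chilbert_space"
  assumes "is_onb E"
  shows "((\<lambda>e. cinner e x *\<^sub>C e) has_sum x) E"
proof -
  from assms have on: "orthonormal E" by (simp add: is_onb_def)
  have "(\<lambda>e. cinner e x *\<^sub>C e) summable_on E"
  proof (rule summable_on_Cauchy)
    fix \<epsilon> :: real assume "\<epsilon> > 0"
    then have "\<epsilon>\<^sup>2 > 0" by simp
    then obtain F where F: "finite F" "F \<subseteq> E"
      "\<And>G. finite G \<Longrightarrow> G \<subseteq> E \<Longrightarrow> G \<inter> F = {} \<Longrightarrow> \<bar>\<Sum>e\<in>G. (cmod (cinner e x))\<^sup>2\<bar> < \<epsilon>\<^sup>2"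
      using summable_on_small_tails[OF Bessel_summable[OF on]] by metis
    have "norm (\<Sum>e\<in>G. cinner e x *\<^sub>C e) < \<epsilon>" if "finite G" "G \<subseteq> E" "G \<inter> F = {}" for G
    proof (rule power_less_imp_less_base)
      show "(norm (\<Sum>e\<in>G. cinner e x *\<^sub>C e))\<^sup>2 < \<epsilon>\<^sup>2"
        using F(3)[OF that] norm_sum_orthonormal[OF on that(1,2), of "\<lambda>e. cinner e x"] by linarith
    qed (use \<open>\<epsilon> > 0\<close> in simp)
    then show "\<exists>F. finite F \<and> F \<subseteq> E \<and> (\<forall>G. finite G \<longrightarrow> G \<subseteq> E \<longrightarrow> G \<inter> F = {} \<longrightarrow>
        norm (\<Sum>e\<in>G. cinner e x *\<^sub>C e) < \<epsilon>)"
      using F by blast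
  qed
  then obtain y where y: "((\<lambda>e. cinner e x *\<^sub>C e) has_sum y) E" by (auto simp: summable_on_def)
  have "cinner f (x - y) = 0" if "f \<in> E" for f
  proof -
    have "((\<lambda>e. cinner f (cinner e x *\<^sub>C e)) has_sum cinner f y) E"
      by (rule has_sum_bounded_linear[OF bounded_linear_cinner_right y])
    moreover have "((\<lambda>e. cinner f (cinner e x *\<^sub>C e)) has_sum cinner f x) E"
      using on that
      by (intro has_sum_finite_neutralI[of "{f}"]) (auto simp: cinner_scaleC_right orthonormal_def)
    ultimately show ?thesis by (simp add: cinner_diff_right has_sum_unique)
  qed
  then have "x - y = 0" using assms by (metis is_onb_def)
  then show ?thesis using y by simp
qed

lemma Parseval_cinner:
  fixes x y :: "'a::chilbert_space"
  assumes "is_onb E"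
  shows "((\<lambda>e. cinner x e * cinner e y) has_sum cinner x y) E"
  using has_sum_bounded_linear[OF bounded_linear_cinner_right has_sum_onb[OF assms, of y], of x]
  by (simp add: cinner_scaleC_right mult.commute)

lemma cinner_mult_swap: "cinner x y * cinner y x = complex_of_real ((cmod (cinner y x))\<^sup>2)"
  by (subst cinner_commute, subst mult.commute) (rule complex_norm_square[symmetric])

lemma Parseval_norm:
  fixes x :: "'a::chilbert_space"
  assumes "is_onb E"
  shows "((\<lambda>e. (cmod (cinner e x))\<^sup>2) has_sum (norm x)\<^sup>2) E"
proof -
  have "((\<lambda>e. complex_of_real ((cmod (cinner e x))\<^sup>2)) has_sum complex_of_real ((norm x)\<^sup>2)) E"
    using Parseval_cinner[OF assms, of x x] by (simp only: cinner_mult_swap cinner_self)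
  then show ?thesis by (simp only: has_sum_of_real_iff)
qed

section \<open>Eigenbasis of a positive trace-class operator\<close>

lemma bounded_clinear_diff: "bounded_clinear T \<Longrightarrow> T (x - y) = T x - T y"
  by (simp add: bounded_clinear_def bounded_linear.linear linear_diff)

lemma bounded_clinear_add: "bounded_clinear T \<Longrightarrow> T (x + y) = T x + T y"
  by (simp add: bounded_clinear_def bounded_linear.linear linear_add)

lemma bounded_clinear_scaleC: "bounded_clinear T \<Longrightarrow> T (c *\<^sub>C x) = c *\<^sub>C T x"
  by (simp add: bounded_clinear_def)

lemma bounded_clinear_scaleR: "bounded_clinear T \<Longrightarrow> T (r *\<^sub>R x) = r *\<^sub>R T x"
  by (simp add: bounded_clinear_def bounded_linear.linear linear_cmul)

lemma positive_op_bounded: "positive_op T \<Longrightarrow> bounded_clinear T"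
  by (simp add: positive_op_def)

lemma positive_op_inner_nonneg:
  assumes "positive_op T"
  shows "0 \<le> inner x (T x)"
proof -
  have "cinner x (T x) \<in> nonneg_Reals" using assms by (simp add: positive_op_def)
  then show ?thesis by (auto simp: inner_eq_Re_cinner nonneg_Reals_def)
qed

lemma positive_op_cinner_self:
  assumes "positive_op T"
  shows "cinner x (T x) = complex_of_real (inner x (T x))"
proof -
  have "cinner x (T x) \<in> nonneg_Reals" using assms by (simp add: positive_op_def)
  then have "Im (cinner x (T x)) = 0" by (auto simp: nonneg_Reals_def)
  then show ?thesis by (simp add: complex_eq_iff inner_eq_Re_cinner)
qed

text \<open>Polarization: the quadratic form is real at \<open>x + y\<close>, which matches the
  imaginary parts, and at \<open>x + \<i> *\<^sub>C y\<close>, which matches the real parts.\<close>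

lemma positive_op_selfadjoint:
  assumes T: "positive_op T"
  shows "cinner (T x) y = cinner x (T y)"
proof -
  note b = positive_op_bounded[OF T]
  have real: "Im (cinner z (T z)) = 0" for z
    by (simp add: positive_op_cinner_self[OF T])
  have "Im (cinner x (T y)) + Im (cinner y (T x)) = 0"
    using real[of "x + y"] real[of x] real[of y]
    by (simp add: bounded_clinear_add[OF b] cinner_add_left cinner_add_right)
  moreover have "Re (cinner x (T y)) - Re (cinner y (T x)) = 0"
    using real[of "x + \<i> *\<^sub>C y"] real[of x] real[of y]
    by (simp add: bounded_clinear_add[OF b] bounded_clinear_scaleC[OF b] cinner_add_left
        cinner_add_right cinner_scaleC_left cinner_scaleC_right)
  ultimately have "cinner x (T y) = cnj (cinner y (T x))" by (simp add: complex_eq_iff)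
  then show ?thesis by (simp flip: cinner_commute)
qed

text \<open>A discriminant argument for the nonnegative quadratic polynomial
  \<open>t \<mapsto> inner (x + t T x) (T (x + t T x))\<close>. The form is bounded by
  \<open>s\<close> at \<open>T x\<close> only, so that \<open>s\<close> may be an operator bound as
  well as a supremum over an invariant set.\<close>

lemma positive_op_norm_le:
  assumes T: "positive_op T" and s: "0 \<le> s" and le: "inner (T x) (T (T x)) \<le> s * (norm (T x))\<^sup>2"
  shows "(norm (T x))\<^sup>2 \<le> s * inner x (T x)"
proof -
  note b = positive_op_bounded[OF T]
  define a n where "a = inner x (T x)" and "n = (norm (T x))\<^sup>2"
  have n0: "0 \<le> n" and a0: "0 \<le> a"
    using positive_op_inner_nonneg[OF T] by (simp_all add: n_def a_def)
  have sym: "inner x (T (T x)) = n"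
    using positive_op_selfadjoint[OF T, of x "T x"]
    by (simp add: n_def power2_norm_eq_inner inner_eq_Re_cinner)
  have quad: "0 \<le> a + 2 * t * n + t\<^sup>2 * (s * n)" for t
  proof -
    have "0 \<le> inner (x + t *\<^sub>R T x) (T (x + t *\<^sub>R T x))"
      by (rule positive_op_inner_nonneg[OF T])
    also have "\<dots> = a + 2 * t * n + t\<^sup>2 * inner (T x) (T (T x))"
      by (simp add: bounded_clinear_add[OF b] bounded_clinear_scaleR[OF b] inner_add_left
          inner_add_right inner_commute[of "T x" x] sym a_def[symmetric] n_def power2_norm_eq_inner
          power2_eq_square[of t] algebra_simps)
    also have "\<dots> \<le> a + 2 * t * n + t\<^sup>2 * (s * n)"
      using le unfolding n_def by (intro add_left_mono mult_left_mono) simp_all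
    finally show ?thesis .
  qed
  show ?thesis
  proof (cases "s = 0")
    case True
    \<comment> \<open>With \<open>s = 0\<close> the polynomial is bounded by an affine function of
      \<open>t\<close>, which takes the value -1 at the chosen \<open>t\<close> unless its slope
      vanishes.\<close>
    have "n = 0"
    proof (rule ccontr)
      assume "n \<noteq> 0"
      then have "a + 2 * (- (a + 1) / (2 * n)) * n = -1" by (simp add: field_simps)
      then show False using quad[of "- (a + 1) / (2 * n)"] True by simp
    qed
    then show ?thesis using True by (simp add: n_def)
  next
    case False
    with s have "s > 0" by simp
    \<comment> \<open>The point \<open>t = - 1 / s\<close> minimizes the quadratic.\<close>
    then have "a + 2 * (- 1 / s) * n + (- 1 / s)\<^sup>2 * (s * n) = a - n / s"
      by (simp add: field_simps power2_eq_square)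
    then have "n / s \<le> a" using quad[of "- 1 / s"] by simp
    then show ?thesis using \<open>s > 0\<close> by (simp add: field_simps n_def a_def)
  qed
qed

section \<open>Compactness of Hilbert-Schmidt operators\<close>

text \<open>Each further vector adds the compact image of the closed unit disc to the compact set
  already found. Finite-rank approximants of \<open>T\<close> map the unit ball into such a
  set.\<close>

lemma compact_combinations:
  fixes g :: "'b \<Rightarrow> 'a::complex_inner"
  assumes "finite F"
  shows "\<exists>C. compact C \<and> (\<forall>c. (\<forall>e\<in>F. cmod (c e) \<le> 1) \<longrightarrow> (\<Sum>e\<in>F. c e *\<^sub>C g e) \<in> C)"
  using assms
proof (induction F)
  case empty
  show ?case by (intro exI[of _ "{0}"]) simp
next
  case (insert f F)
  then obtain C where C: "compact C"
    "\<And>c. (\<forall>e\<in>F. cmod (c e) \<le> 1) \<Longrightarrow> (\<Sum>e\<in>F. c e *\<^sub>C g e) \<in> C" by blast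
  let ?D = "(\<lambda>c. c *\<^sub>C g f) ` cball 0 1"
  have "compact ?D"
    by (intro compact_continuous_image continuous_on_subset[OF continuous_scaleC_left]) auto
  then have "compact {x + y |x y. x \<in> ?D \<and> y \<in> C}"
    using C(1) by (rule compact_sums)
  moreover have "(\<Sum>e\<in>insert f F. c e *\<^sub>C g e) \<in> {x + y |x y. x \<in> ?D \<and> y \<in> C}"
    if "\<forall>e\<in>insert f F. cmod (c e) \<le> 1" for c
  proof -
    have "c f *\<^sub>C g f \<in> ?D" using that by auto
    moreover have "(\<Sum>e\<in>F. c e *\<^sub>C g e) \<in> C" using that by (intro C(2)) auto
    moreover have "(\<Sum>e\<in>insert f F. c e *\<^sub>C g e) = c f *\<^sub>C g f + (\<Sum>e\<in>F. c e *\<^sub>C g e)"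
      using insert by simp
    ultimately show ?thesis by blast
  qed
  ultimately show ?case by blast
qed

lemma norm_has_sum_le_partial_sums:
  fixes g :: "'b \<Rightarrow> 'a::real_normed_vector"
  assumes "(g has_sum S) A" "\<And>G. finite G \<Longrightarrow> G \<subseteq> A \<Longrightarrow> norm (sum g G) \<le> c"
  shows "norm S \<le> c"
  by (rule Lim_norm_ubound[OF _ assms(1)[unfolded has_sum_def]])
    (auto intro!: eventually_finite_subsets_at_top_weakI assms(2))

lemma has_sum_finite_sum:
  fixes g :: "'i \<Rightarrow> 'b \<Rightarrow> 'a::topological_comm_monoid_add"
  assumes "\<And>i. i \<in> I \<Longrightarrow> (g i has_sum s i) A"
  shows "((\<lambda>x. \<Sum>i\<in>I. g i x) has_sum (\<Sum>i\<in>I. s i)) A"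
  using assms by (induction I rule: infinite_finite_induct) (auto intro: has_sum_add)

text \<open>The remainder is a sum over basis vectors outside \<open>F\<close>. Cauchy-Schwarz
  splits it into the coefficients of \<open>x\<close>, controlled by Bessel, and a small tail of the
  Hilbert-Schmidt series.\<close>

lemma Hilbert_Schmidt_finite_rank_approx:
  fixes T :: "'a::chilbert_space \<Rightarrow> 'a"
  assumes T: "bounded_clinear T" and E: "is_onb E"
    and hs: "(\<lambda>e. (norm (T e))\<^sup>2) summable_on E" and "\<epsilon> > 0"
  obtains F where "finite F" "F \<subseteq> E"
    "\<And>x. norm x \<le> 1 \<Longrightarrow> norm (T x - (\<Sum>e\<in>F. cinner e x *\<^sub>C T e)) \<le> \<epsilon>"
proof -
  from E have on: "orthonormal E" by (simp add: is_onb_def)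
  have "\<epsilon>\<^sup>2 > 0" using \<open>\<epsilon> > 0\<close> by simp
  then obtain F where F: "finite F" "F \<subseteq> E" and tail:
    "\<And>G. finite G \<Longrightarrow> G \<subseteq> E \<Longrightarrow> G \<inter> F = {} \<Longrightarrow> \<bar>\<Sum>e\<in>G. (norm (T e))\<^sup>2\<bar> < \<epsilon>\<^sup>2"
    using summable_on_small_tails[OF hs] by metis
  show ?thesis
  proof (rule that[OF F])
    fix x :: 'a assume x: "norm x \<le> 1"
    let ?g = "\<lambda>e. cinner e x *\<^sub>C T e"
    have "(?g has_sum T x) E"
      using has_sum_bounded_linear[OF _ has_sum_onb[OF E, of x], of T] T
      by (simp add: bounded_clinear_def)
    then have diff: "(?g has_sum (T x - sum ?g F)) (E - F)"
      using F by (intro has_sum_Diff has_sum_finite) auto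
    show "norm (T x - sum ?g F) \<le> \<epsilon>"
    proof (rule norm_has_sum_le_partial_sums[OF diff])
      fix G assume G: "finite G" "G \<subseteq> E - F"
      then have "G \<subseteq> E" by blast
      have "norm (sum ?g G) \<le> (\<Sum>e\<in>G. \<bar>cmod (cinner e x)\<bar> * \<bar>norm (T e)\<bar>)"
        by (rule order_trans[OF norm_sum]) (simp add: norm_scaleC)
      also have "\<dots> \<le> L2_set (\<lambda>e. cmod (cinner e x)) G * L2_set (\<lambda>e. norm (T e)) G"
        by (rule L2_set_mult_ineq)
      also have "\<dots> \<le> 1 * \<epsilon>"
      proof (rule mult_mono)
        have "(\<Sum>e\<in>G. (cmod (cinner e x))\<^sup>2) \<le> 1"
          using Bessel_finite[OF on G(1) \<open>G \<subseteq> E\<close>, of x] x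
          by (meson norm_ge_zero order_trans power_le_one)
        then show "L2_set (\<lambda>e. cmod (cinner e x)) G \<le> 1" by (simp add: L2_set_def)
        have "(\<Sum>e\<in>G. (norm (T e))\<^sup>2) \<le> \<epsilon>\<^sup>2" using tail[of G] G by force
        then show "L2_set (\<lambda>e. norm (T e)) G \<le> \<epsilon>"
          unfolding L2_set_def using \<open>\<epsilon> > 0\<close> by (intro real_le_lsqrt) (auto simp: sum_nonneg)
      qed (simp_all add: L2_set_nonneg)
      finally show "norm (sum ?g G) \<le> \<epsilon>" by simp
    qed
  qed
qed

text \<open>Total boundedness is inherited from the compact ranges of the finite-rank
  approximants.\<close>

lemma Hilbert_Schmidt_compact:
  fixes T :: "'a::chilbert_space \<Rightarrow> 'a"
  assumes T: "bounded_clinear T" and E: "is_onb E"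
    and hs: "(\<lambda>e. (norm (T e))\<^sup>2) summable_on E"
  shows "compact (closure (T ` cball 0 1))"
  unfolding compact_eq_totally_bounded
proof (intro conjI allI impI)
  from E have on: "orthonormal E" by (simp add: is_onb_def)
  show "complete (closure (T ` cball 0 1))" by (simp add: complete_eq_closed)
  fix \<epsilon> :: real assume "\<epsilon> > 0"
  \<comment> \<open>One quarter is spent on the approximation and one on the net, giving closed
    balls of radius \<open>\<epsilon> / 2\<close>. Their finite union is closed, so it covers the
    closure too, and it fits into open balls of radius \<open>\<epsilon>\<close>.\<close>
  then have "\<epsilon> / 4 > 0" by simp
  obtain F where F: "finite F" "F \<subseteq> E"
    "\<And>x. norm x \<le> 1 \<Longrightarrow> norm (T x - (\<Sum>e\<in>F. cinner e x *\<^sub>C T e)) \<le> \<epsilon> / 4"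
    using Hilbert_Schmidt_finite_rank_approx[OF T E hs \<open>\<epsilon> / 4 > 0\<close>] by metis
  obtain C where C: "compact C"
    "\<And>c. (\<forall>e\<in>F. cmod (c e) \<le> 1) \<Longrightarrow> (\<Sum>e\<in>F. c e *\<^sub>C T e) \<in> C"
    using compact_combinations[OF F(1), of T] by blast
  obtain k where k: "finite k" "C \<subseteq> (\<Union>x\<in>k. ball x (\<epsilon> / 4))"
    using C(1) \<open>\<epsilon> / 4 > 0\<close> unfolding compact_eq_totally_bounded by blast
  have "T ` cball 0 1 \<subseteq> (\<Union>x\<in>k. cball x (\<epsilon> / 2))"
  proof (rule image_subsetI)
    fix x :: 'a assume "x \<in> cball 0 1"
    then have x: "norm x \<le> 1" by simp
    let ?y = "\<Sum>e\<in>F. cinner e x *\<^sub>C T e"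
    have "cmod (cinner e x) \<le> 1" if "e \<in> F" for e
    proof -
      have "norm e = 1" using F(2) on that by (intro norm_orthonormal[of E]) auto
      then show ?thesis using cmod_cinner_le[of e x] x by simp
    qed
    then have "?y \<in> C" by (intro C(2)) blast
    then obtain z where z: "z \<in> k" "dist z ?y < \<epsilon> / 4" using k(2) by auto
    have "dist z (T x) \<le> dist z ?y + dist (T x) ?y" by (rule dist_triangle2)
    also have "\<dots> \<le> \<epsilon> / 2" using z(2) F(3)[OF x] by (simp add: dist_norm)
    finally show "T x \<in> (\<Union>x\<in>k. cball x (\<epsilon> / 2))" using z(1) by auto
  qed
  moreover have "closed (\<Union>x\<in>k. cball x (\<epsilon> / 2))" using k(1) by (intro closed_UN) auto
  ultimately have "closure (T ` cball 0 1) \<subseteq> (\<Union>x\<in>k. cball x (\<epsilon> / 2))"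
    by (rule closure_minimal)
  also have "\<dots> \<subseteq> (\<Union>x\<in>k. ball x \<epsilon>)"
    using \<open>\<epsilon> > 0\<close> by (intro UN_mono subset_refl) (auto simp: subset_eq)
  finally show "\<exists>k. finite k \<and> closure (T ` cball 0 1) \<subseteq> (\<Union>x\<in>k. ball x \<epsilon>)"
    using k(1) by blast
qed

text \<open>An operator bound \<open>K\<close> gives that the squared norm of \<open>T e\<close> is
  at most \<open>K * inner e (T e)\<close>, so the trace series dominates the Hilbert-Schmidt
  series.\<close>

lemma positive_op_trace_Hilbert_Schmidt:
  assumes T: "positive_op T" and sum: "(\<lambda>e. cinner e (T e)) summable_on E"
  shows "(\<lambda>e. (norm (T e))\<^sup>2) summable_on E"
proof -
  have "bounded_linear T" using T by (simp add: positive_op_def bounded_clinear_def)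
  then obtain K where K: "K > 0" "\<And>x. norm (T x) \<le> norm x * K"
    using bounded_linear.pos_bounded by metis
  have "(norm (T x))\<^sup>2 \<le> K * inner x (T x)" for x
  proof (rule positive_op_norm_le[OF T])
    have "inner (T x) (T (T x)) \<le> norm (T x) * norm (T (T x))" by (rule norm_cauchy_schwarz)
    also have "\<dots> \<le> norm (T x) * (norm (T x) * K)" by (intro mult_left_mono K(2)) simp
    finally show "inner (T x) (T (T x)) \<le> K * (norm (T x))\<^sup>2"
      by (simp add: power2_eq_square mult_ac)
  qed (use K(1) in simp)
  moreover have "(\<lambda>e. K * inner e (T e)) summable_on E"
    using summable_on_Re[OF sum] by (intro summable_on_cmult_right) (simp add: inner_eq_Re_cinner)
  ultimately show ?thesis
    by (rule_tac summable_on_comparison_test) simp_all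
qed

section \<open>Spectral theorem for positive compact operators\<close>

text \<open>The supremum \<open>s\<close> of the quadratic form on unit vectors of \<open>V\<close>
  is attained at an eigenvector, by compactness. In the application \<open>V\<close> is the
  orthogonal complement of the eigenvectors already found.\<close>

lemma positive_compact_eigenvector:
  fixes T :: "'a::chilbert_space \<Rightarrow> 'a"
  assumes T: "positive_op T" and cpt: "compact (closure (T ` cball 0 1))"
    and V: "closed V" "\<And>x. x \<in> V \<Longrightarrow> T x \<in> V" "\<And>r x. x \<in> V \<Longrightarrow> r *\<^sub>R x \<in> V"
    and w: "w \<in> V" "w \<noteq> 0"
  obtains v \<mu> where "v \<in> V" "norm v = 1" "0 \<le> \<mu>" "T v = \<mu> *\<^sub>R v"
proof -
  note b = positive_op_bounded[OF T]
  have bl: "bounded_linear T" using b by (simp add: bounded_clinear_def)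
  then obtain K where K: "K > 0" "\<And>x. norm (T x) \<le> norm x * K"
    using bounded_linear.pos_bounded by metis
  define S where "S = (\<lambda>x. inner x (T x)) ` {x \<in> V. norm x = 1}"
  define s where "s = Sup S"
  have "sgn w \<in> V" "norm (sgn w) = 1" using w V(3) by (simp_all add: sgn_div_norm norm_sgn)
  then have "S \<noteq> {}" by (auto simp: S_def)
  have "inner x (T x) \<le> K" if "norm x = 1" for x
    using norm_cauchy_schwarz[of x "T x"] K(2)[of x] that by simp
  then have bdd: "bdd_above S" by (auto simp: S_def intro!: bdd_aboveI[of _ K])
  have upper: "inner x (T x) \<le> s" if "x \<in> V" "norm x = 1" for x
    unfolding s_def using bdd that by (intro cSup_upper) (auto simp: S_def)
  have s0: "0 \<le> s"
    using upper[OF \<open>sgn w \<in> V\<close> \<open>norm (sgn w) = 1\<close>] positive_op_inner_nonneg[OF T, of "sgn w"]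
    by linarith
  have form: "inner x (T x) \<le> s * (norm x)\<^sup>2" if "x \<in> V" for x
  proof (cases "x = 0")
    case False
    have "x = norm x *\<^sub>R sgn x" using False by (simp add: sgn_div_norm)
    then have "inner x (T x) = (norm x)\<^sup>2 * inner (sgn x) (T (sgn x))"
      using bounded_clinear_scaleR[OF b, of "norm x" "sgn x"]
      by (metis inner_scaleR_left inner_scaleR_right mult.assoc power2_eq_square)
    also have "\<dots> \<le> (norm x)\<^sup>2 * s"
      using False that by (intro mult_left_mono upper) (simp_all add: norm_sgn sgn_div_norm V(3))
    finally show ?thesis by (simp add: mult.commute)
  qed simp
  have key: "(norm (T x))\<^sup>2 \<le> s * inner x (T x)" if "x \<in> V" for x
    by (rule positive_op_norm_le[OF T s0 form[OF V(2)[OF that]]])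
  show ?thesis
  proof (cases "s = 0")
    \<comment> \<open>Here \<open>T\<close> kills \<open>V\<close>, so any unit vector of
      \<open>V\<close> serves, with eigenvalue 0; the limit argument below divides by
      \<open>s\<close>.\<close>
    case True
    then have "T (sgn w) = 0" using key[OF \<open>sgn w \<in> V\<close>] by simp
    then show ?thesis using that[of "sgn w" 0] \<open>sgn w \<in> V\<close> \<open>norm (sgn w) = 1\<close> by simp
  next
    case False
    with s0 have "s > 0" by simp
    have "\<exists>x. x \<in> V \<and> norm x = 1 \<and> s - inverse (real (Suc n)) < inner x (T x)" for n
    proof -
      have "s - inverse (real (Suc n)) < Sup S" by (simp add: s_def)
      then obtain y where "y \<in> S" "s - inverse (real (Suc n)) < y"
        using less_cSupD[OF \<open>S \<noteq> {}\<close>] by blast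
      then show ?thesis by (auto simp: S_def)
    qed
    then obtain X where X: "\<And>n. X n \<in> V" "\<And>n. norm (X n) = 1"
      "\<And>n. s - inverse (real (Suc n)) < inner (X n) (T (X n))" by metis
    \<comment> \<open>A maximizing sequence consists of approximate eigenvectors: by
      \<open>key\<close> the residual is controlled by the gap to the supremum.\<close>
    have res: "(norm (T (X n) - s *\<^sub>R X n))\<^sup>2 \<le> s * inverse (real (Suc n))" for n
    proof -
      have "(norm (T (X n) - s *\<^sub>R X n))\<^sup>2
          = (norm (T (X n)))\<^sup>2 - 2 * s * inner (X n) (T (X n)) + s\<^sup>2 * (norm (X n))\<^sup>2"
        by (simp add: power2_norm_eq_inner inner_diff_left inner_diff_right inner_commute
            power2_eq_square[of s] algebra_simps)
      also have "\<dots> \<le> s * inner (X n) (T (X n)) - 2 * s * inner (X n) (T (X n)) + s\<^sup>2"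
        using key[OF X(1)[of n]] X(2)[of n] by simp
      also have "\<dots> = s * (s - inner (X n) (T (X n)))"
        by (simp add: power2_eq_square algebra_simps)
      also have "\<dots> \<le> s * inverse (real (Suc n))"
        using X(3)[of n] s0 by (intro mult_left_mono) linarith+
      finally show ?thesis .
    qed
    have "(\<lambda>n. s * inverse (real (Suc n))) \<longlonglongrightarrow> s * 0"
      by (intro tendsto_mult tendsto_const LIMSEQ_inverse_real_of_nat)
    then have inv0: "(\<lambda>n. s * inverse (real (Suc n))) \<longlonglongrightarrow> 0" by simp
    have "(\<lambda>n. (norm (T (X n) - s *\<^sub>R X n))\<^sup>2) \<longlonglongrightarrow> 0"
      by (rule real_tendsto_sandwich[OF _ _ tendsto_const inv0])
        (intro always_eventually allI zero_le_power2 res)+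
    then have "(\<lambda>n. sqrt ((norm (T (X n) - s *\<^sub>R X n))\<^sup>2)) \<longlonglongrightarrow> sqrt 0"
      by (rule tendsto_real_sqrt)
    then have res0: "(\<lambda>n. T (X n) - s *\<^sub>R X n) \<longlonglongrightarrow> 0"
      by (simp add: tendsto_norm_zero_iff)
    have "\<forall>n. T (X n) \<in> closure (T ` cball 0 1)"
      using X(2) by (intro allI subsetD[OF closure_subset]) auto
    then obtain y r where r: "strict_mono r" and y: "((\<lambda>n. T (X n)) \<circ> r) \<longlonglongrightarrow> y"
      using cpt[unfolded compact_def, THEN spec[of _ "\<lambda>n. T (X n)"]] by blast
    \<comment> \<open>Compactness yields convergence of \<open>T (X (r n))\<close> only. Subtracting
      the vanishing residual transfers it to \<open>s *\<^sub>R X (r n)\<close>, and hence to the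
      vectors themselves.\<close>
    have "(\<lambda>n. T (X (r n)) - (T (X (r n)) - s *\<^sub>R X (r n))) \<longlonglongrightarrow> y - 0"
      using y LIMSEQ_subseq_LIMSEQ[OF res0 r] by (intro tendsto_diff) (simp_all add: o_def)
    then have "(\<lambda>n. inverse s *\<^sub>R (s *\<^sub>R X (r n))) \<longlonglongrightarrow> inverse s *\<^sub>R y"
      by (intro tendsto_scaleR tendsto_const) simp
    then have lim: "(\<lambda>n. X (r n)) \<longlonglongrightarrow> inverse s *\<^sub>R y" using \<open>s > 0\<close> by simp
    define z where "z = inverse s *\<^sub>R y"
    have "z \<in> V"
      by (rule closed_sequentially[OF V(1) _ lim[folded z_def]]) (simp add: X(1))
    moreover have "norm z = 1"
      using LIMSEQ_unique[OF tendsto_norm[OF lim[folded z_def]]] X(2) by simp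
    moreover have "T z = s *\<^sub>R z"
    proof -
      have "(\<lambda>n. T (X (r n))) \<longlonglongrightarrow> T z"
        by (rule bounded_linear.tendsto[OF bl lim[folded z_def]])
      then have "T z = y" using y LIMSEQ_unique by (auto simp: o_def)
      then show ?thesis using \<open>s > 0\<close> by (simp add: z_def)
    qed
    ultimately show ?thesis using that[of z s] s0 by simp
  qed
qed

text \<open>Zorn's lemma gives a maximal orthonormal set of eigenvectors. Its orthogonal complement
  is closed and invariant, so if it were nonzero it would contain one more eigenvector.\<close>

lemma ex_eigenbasis:
  fixes T :: "'a::chilbert_space \<Rightarrow> 'a"
  assumes T: "positive_op T" and cpt: "compact (closure (T ` cball 0 1))"
  shows "\<exists>F. is_onb F \<and> (\<forall>f\<in>F. \<exists>\<mu>\<ge>0. T f = \<mu> *\<^sub>R f)"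
proof -
  define P where "P = {F. orthonormal F \<and> (\<forall>f\<in>F. \<exists>\<mu>\<ge>0. T f = \<mu> *\<^sub>R f)}"
  have "\<exists>M\<in>P. \<forall>X\<in>P. M \<subseteq> X \<longrightarrow> X = M"
  proof (rule subset_Zorn')
    fix C assume C: "subset.chain P C"
    have "cinner e f = (if e = f then 1 else 0)" if ef: "e \<in> \<Union>C" "f \<in> \<Union>C" for e f
    proof -
      from ef obtain X Y where XY: "X \<in> C" "e \<in> X" "Y \<in> C" "f \<in> Y" by blast
      have "X \<subseteq> Y \<or> Y \<subseteq> X" using C XY by (auto simp: subset_chain_def)
      then obtain Z where "Z \<in> C" "e \<in> Z" "f \<in> Z" using XY by blast
      moreover have "orthonormal Z" using C \<open>Z \<in> C\<close> by (auto simp: subset_chain_def P_def)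
      ultimately show ?thesis by (auto simp: orthonormal_def)
    qed
    moreover have "\<forall>f\<in>\<Union>C. \<exists>\<mu>\<ge>0. T f = \<mu> *\<^sub>R f"
      using C by (auto simp: subset_chain_def P_def)
    ultimately show "\<Union>C \<in> P" by (simp add: orthonormal_def P_def)
  qed
  then obtain M where M: "orthonormal M" "\<And>f. f \<in> M \<Longrightarrow> \<exists>\<mu>\<ge>0. T f = \<mu> *\<^sub>R f"
    and max: "\<And>X. X \<in> P \<Longrightarrow> M \<subseteq> X \<Longrightarrow> X = M" by (auto simp: P_def)
  define V where "V = {x. \<forall>f\<in>M. cinner f x = 0}"
  have "w = 0" if "w \<in> V" for w
  proof (rule ccontr)
    assume "w \<noteq> 0"
    have "V = (\<Inter>f\<in>M. {x. cinner f x = 0})" by (auto simp: V_def)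
    moreover have "closed {x. cinner f x = 0}" for f :: 'a
      by (intro closed_Collect_eq continuous_on_const
          linear_continuous_on[OF bounded_linear_cinner_right])
    ultimately have "closed V" by auto
    moreover have "T x \<in> V" if "x \<in> V" for x
    proof -
      have "cinner f (T x) = 0" if "f \<in> M" for f
      proof -
        obtain \<mu> where "T f = \<mu> *\<^sub>R f" using M(2)[OF \<open>f \<in> M\<close>] by blast
        moreover have "cinner f x = 0" using \<open>x \<in> V\<close> that by (simp add: V_def)
        ultimately show ?thesis
          by (metis cinner_scaleC_left mult_zero_right positive_op_selfadjoint[OF T] scaleR_scaleC)
      qed
      then show ?thesis by (simp add: V_def)
    qed
    moreover have "r *\<^sub>R x \<in> V" if "x \<in> V" for r x
      using that by (simp add: V_def scaleR_scaleC[where 'a='a] cinner_scaleC_right)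
    ultimately obtain v \<mu> where v: "v \<in> V" "norm v = 1" "0 \<le> \<mu>" "T v = \<mu> *\<^sub>R v"
      using positive_compact_eigenvector[OF T cpt _ _ _ \<open>w \<in> V\<close> \<open>w \<noteq> 0\<close>] by metis
    have vv: "cinner v v = 1" using v(2) by (simp add: cinner_self)
    have fv: "cinner f v = 0" "cinner v f = 0" if "f \<in> M" for f
    proof -
      show "cinner f v = 0" using v(1) that by (simp add: V_def)
      then show "cinner v f = 0" using cinner_commute[of v f] by simp
    qed
    have "insert v M \<in> P"
      using M vv fv v(3,4) by (auto simp: P_def orthonormal_def)
    then have "v \<in> M" using max by blast
    then show False using fv(1) vv by force
  qed
  then show ?thesis using M by (auto simp: is_onb_def V_def)
qed

section \<open>Diagonalization of a positive trace-class operator\<close>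

text \<open>The definition of trace class supplies \<open>P\<close>, the absolute value of
  \<open>\<rho>\<close>, and compactness is available for \<open>P\<close>. An eigenbasis of
  \<open>P\<close> also diagonalizes \<open>\<rho>\<close>, with the same eigenvalues, since both
  operators are positive with equal squares.\<close>

lemma trace_class_eigenbasis:
  fixes \<rho> :: "'a::chilbert_space \<Rightarrow> 'a"
  assumes \<rho>: "positive_op \<rho>" "trace_class \<rho>"
  obtains F \<mu> where "is_onb F" "\<And>f. f \<in> F \<Longrightarrow> 0 \<le> \<mu> f" "\<And>f. f \<in> F \<Longrightarrow> \<rho> f = \<mu> f *\<^sub>R f"
    "\<mu> summable_on F"
proof -
  obtain P E where P: "positive_op P" and sq: "\<And>x y. cinner (P x) (P y) = cinner (\<rho> x) (\<rho> y)"
    and E: "is_onb E" and tr: "(\<lambda>e. cinner e (P e)) summable_on E"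
    using \<rho>(2) by (auto simp: trace_class_def)
  have "compact (closure (P ` cball 0 1))"
    using Hilbert_Schmidt_compact[OF positive_op_bounded[OF P] E]
      positive_op_trace_Hilbert_Schmidt[OF P tr] by blast
  then obtain F \<mu> where F: "is_onb F" and \<mu>0: "\<And>f. f \<in> F \<Longrightarrow> 0 \<le> \<mu> f"
    and eig: "\<And>f. f \<in> F \<Longrightarrow> P f = \<mu> f *\<^sub>R f"
    using ex_eigenbasis[OF P] by metis
  note b = positive_op_bounded[OF \<rho>(1)]
  have eig\<rho>: "\<rho> f = \<mu> f *\<^sub>R f" if f: "f \<in> F" for f
  proof -
    let ?m = "complex_of_real (\<mu> f)"
    have Pf: "P f = ?m *\<^sub>C f" using eig[OF f] by (simp add: scaleR_scaleC)
    have "cinner x (\<rho> (\<rho> f)) = cinner x ((?m * ?m) *\<^sub>C f)" for x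
    proof -
      have "cinner x (\<rho> (\<rho> f)) = cinner (P x) (P f)"
        by (simp add: sq positive_op_selfadjoint[OF \<rho>(1)])
      also have "\<dots> = ?m * cinner x (P f)"
        by (simp add: Pf cinner_scaleC_right positive_op_selfadjoint[OF P])
      finally show ?thesis by (simp add: Pf cinner_scaleC_right)
    qed
    then have "cinner x (\<rho> (\<rho> f) - (?m * ?m) *\<^sub>C f) = 0" for x
      by (simp add: cinner_diff_right)
    from this[of "\<rho> (\<rho> f) - (?m * ?m) *\<^sub>C f"]
    have rr: "\<rho> (\<rho> f) = (?m * ?m) *\<^sub>C f" by (simp add: cinner_self)
    show ?thesis
    proof (cases "\<mu> f = 0")
      case True
      then have "cinner (\<rho> f) (\<rho> f) = 0" by (simp add: sq[symmetric] eig[OF f])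
      then show ?thesis using True by (simp add: cinner_self)
    next
      case False
      \<comment> \<open>Because \<open>\<rho>\<close> squared acts on \<open>f\<close> as the square
        of \<open>\<mu> f\<close>, this \<open>g\<close> satisfies
        \<open>\<rho> g = - (\<mu> f *\<^sub>R g)\<close>. Positivity excludes a negative
        eigenvalue, so \<open>g\<close> vanishes.\<close>
      define g where "g = \<rho> f - ?m *\<^sub>C f"
      have "\<rho> g = - (?m *\<^sub>C g)"
        by (simp add: g_def bounded_clinear_diff[OF b] bounded_clinear_scaleC[OF b] rr
            complex_vector.scale_right_diff_distrib scaleC_scaleC)
      then have "\<rho> g = - (\<mu> f *\<^sub>R g)" by (simp add: scaleR_scaleC)
      then have "0 \<le> - (\<mu> f * (norm g)\<^sup>2)"
        using positive_op_inner_nonneg[OF \<rho>(1), of g] by (simp add: power2_norm_eq_inner)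
      then have "g = 0" using \<mu>0[OF f] False
        by (smt (verit) mult_pos_pos zero_less_norm_iff zero_less_power)
      then show ?thesis by (simp add: g_def scaleR_scaleC)
    qed
  qed
  have \<mu>_sum: "\<mu> summable_on F"
  proof (rule nonneg_bounded_partial_sums_imp_summable_on[OF \<mu>0])
    let ?t = "\<lambda>e. inner e (P e)"
    have tr': "?t summable_on E"
      using summable_on_Re[OF tr] by (simp add: inner_eq_Re_cinner)
    show "\<forall>\<^sub>F G in finite_subsets_at_top F. sum \<mu> G \<le> infsum ?t E"
    proof (rule eventually_finite_subsets_at_top_weakI)
      fix G assume G: "finite G" "G \<subseteq> F"
      \<comment> \<open>The trace of \<open>P\<close> is given in the basis \<open>E\<close>, the
        eigenvalues belong to \<open>F\<close>. Parseval in \<open>E\<close> rewrites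
        \<open>sum \<mu> G\<close>; Parseval in \<open>F\<close> bounds each summand by the
        corresponding diagonal entry of \<open>P\<close>.\<close>
      have "((\<lambda>e. \<Sum>f\<in>G. \<mu> f * (cmod (cinner e f))\<^sup>2) has_sum (\<Sum>f\<in>G. \<mu> f * (norm f)\<^sup>2)) E"
        by (intro has_sum_finite_sum has_sum_cmult_right Parseval_norm E)
      moreover have "(\<Sum>f\<in>G. \<mu> f * (norm f)\<^sup>2) = sum \<mu> G"
      proof (intro sum.cong refl)
        fix f assume "f \<in> G"
        then have "norm f = 1" using F G by (intro norm_orthonormal[of F]) (auto simp: is_onb_def)
        then show "\<mu> f * (norm f)\<^sup>2 = \<mu> f" by simp
      qed
      ultimately have "((\<lambda>e. \<Sum>f\<in>G. \<mu> f * (cmod (cinner e f))\<^sup>2) has_sum sum \<mu> G) E" by simp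
      moreover have "(\<Sum>f\<in>G. \<mu> f * (cmod (cinner e f))\<^sup>2) \<le> ?t e" for e
      proof -
        have "cinner e f * cinner f (P e) = complex_of_real (\<mu> f * (cmod (cinner e f))\<^sup>2)"
          if "f \<in> F" for f
        proof -
          have "cinner f (P e) = complex_of_real (\<mu> f) * cinner f e"
            using eig[OF that] by (simp add: scaleR_scaleC cinner_scaleC_left flip: positive_op_selfadjoint[OF P])
          then show ?thesis using cinner_mult_swap[of f e] by (simp add: mult_ac)
        qed
        then have "((\<lambda>f. complex_of_real (\<mu> f * (cmod (cinner e f))\<^sup>2)) has_sum cinner e (P e)) F"
          using Parseval_cinner[OF F, of e "P e"] by (simp cong: has_sum_cong)
        then have "((\<lambda>f. \<mu> f * (cmod (cinner e f))\<^sup>2) has_sum ?t e) F"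
          by (simp only: positive_op_cinner_self[OF P] has_sum_of_real_iff)
        then show ?thesis
          using G \<mu>0 by (intro finite_sum_le_has_sum) auto
      qed
      ultimately show "sum \<mu> G \<le> infsum ?t E"
        using has_sum_infsum[OF tr'] has_sum_mono by blast
    qed
  qed
  show ?thesis by (rule that[of F \<mu>]) (fact F \<mu>0 eig\<rho> \<mu>_sum)+
qed

section \<open>Expectation values in an eigenbasis\<close>

lemma bounded_clinear_linear_combinations:
  "bounded_clinear (\<lambda>x::'a::complex_inner. x)"
  "bounded_clinear (\<lambda>x::'a::complex_inner. c *\<^sub>C x)"
  "bounded_clinear X \<Longrightarrow> bounded_clinear Y \<Longrightarrow> bounded_clinear (\<lambda>x::'a::complex_inner. X x + Y x)"
  "bounded_clinear X \<Longrightarrow> bounded_clinear Y \<Longrightarrow> bounded_clinear (\<lambda>x::'a::complex_inner. X x - Y x)"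
  "bounded_clinear X \<Longrightarrow> bounded_clinear (\<lambda>x::'a::complex_inner. c *\<^sub>C X x)"
  unfolding bounded_clinear_def
  by (simp_all add: scaleC_add_right complex_vector.scale_right_diff_distrib
      complex_vector.scale_left_commute bounded_linear_ident bounded_linear_add bounded_linear_sub
      bounded_linear_scaleC bounded_linear_compose[OF bounded_linear_scaleC, of X])

lemma bounded_clinear_compose:
  "bounded_clinear X \<Longrightarrow> bounded_clinear Y \<Longrightarrow> bounded_clinear (\<lambda>x::'a::complex_inner. X (Y x))"
  by (simp add: bounded_clinear_def bounded_linear_compose[of X Y])

text \<open>A state together with a chosen eigenbasis; trace class enters only as summability of the
  eigenvalues.\<close>

locale diagonalized_state =
  fixes \<rho> :: "'a::chilbert_space \<Rightarrow> 'a" and F :: "'a set" and \<mu> :: "'a \<Rightarrow> real"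
  assumes positive: "positive_op \<rho>"
    and trace_one: "trace_op \<rho> = 1"
    and onb: "is_onb F"
    and eigenvalue_nonneg: "\<And>f. f \<in> F \<Longrightarrow> 0 \<le> \<mu> f"
    and eigenvector: "\<And>f. f \<in> F \<Longrightarrow> \<rho> f = \<mu> f *\<^sub>R f"
    and summable: "\<mu> summable_on F"
begin

lemma norm_eigenvector: "f \<in> F \<Longrightarrow> norm f = 1"
  using onb norm_orthonormal by (auto simp: is_onb_def)

text \<open>Fubini for the double series \<open>\<mu> f * (cinner f e * cinner e (Y f))\<close>.\<close>

lemma ex_trace_has_sum:
  assumes Y: "bounded_clinear Y" and E: "is_onb E"
  shows "\<exists>S. ((\<lambda>f. complex_of_real (\<mu> f) * cinner f (Y f)) has_sum S) F \<and>
    ((\<lambda>e. cinner e (Y (\<rho> e))) has_sum S) E"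
proof -
  define g where "g = (\<lambda>(f, e). complex_of_real (\<mu> f) * (cinner f e * cinner e (Y f)))"
  \<comment> \<open>A summable majorant of \<open>g\<close>: a product of two moduli is at most the
    sum of their squares, and Parseval sums the squares over \<open>e\<close>.\<close>
  define h where "h = (\<lambda>(f, e). \<mu> f * ((cmod (cinner e f))\<^sup>2 + (cmod (cinner e (Y f)))\<^sup>2))"
  have bl: "bounded_linear Y" using Y by (simp add: bounded_clinear_def)
  then obtain K where K: "K > 0" "\<And>x. norm (Y x) \<le> norm x * K"
    using bounded_linear.pos_bounded by metis
  have "h summable_on F \<times> E"
  proof (rule summable_on_SigmaI)
    show "((\<lambda>e. h (f, e)) has_sum \<mu> f * ((norm f)\<^sup>2 + (norm (Y f))\<^sup>2)) E" for f
      unfolding h_def by (simp, intro has_sum_cmult_right has_sum_add Parseval_norm E)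
    have "(\<lambda>f. \<mu> f * (1 + K\<^sup>2)) summable_on F"
      by (intro summable_on_cmult_left summable)
    moreover have "\<mu> f * ((norm f)\<^sup>2 + (norm (Y f))\<^sup>2) \<le> \<mu> f * (1 + K\<^sup>2)" if "f \<in> F" for f
    proof (intro mult_left_mono eigenvalue_nonneg that)
      have "norm (Y f) \<le> K" using K(2)[of f] norm_eigenvector[OF that] by simp
      then have "(norm (Y f))\<^sup>2 \<le> K\<^sup>2" by (intro power_mono) simp_all
      then show "(norm f)\<^sup>2 + (norm (Y f))\<^sup>2 \<le> 1 + K\<^sup>2" using norm_eigenvector[OF that] by simp
    qed
    ultimately show "(\<lambda>f. \<mu> f * ((norm f)\<^sup>2 + (norm (Y f))\<^sup>2)) summable_on F"
      by (rule summable_on_comparison_test) (simp_all add: eigenvalue_nonneg)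
    show "0 \<le> h (f, e)" if "f \<in> F" for f e
      using eigenvalue_nonneg[OF that] by (simp add: h_def)
  qed
  moreover have "norm (g p) \<le> h p" if p: "p \<in> F \<times> E" for p
  proof -
    obtain f e where fe: "p = (f, e)" "f \<in> F" using p by auto
    have "cmod (cinner f e) = cmod (cinner e f)" by (metis cinner_commute complex_mod_cnj)
    then have "cmod (cinner f e) * cmod (cinner e (Y f))
        \<le> (cmod (cinner e f))\<^sup>2 + (cmod (cinner e (Y f)))\<^sup>2"
      using sum_squares_bound[of "cmod (cinner e f)" "cmod (cinner e (Y f))"]
        mult_nonneg_nonneg[OF norm_ge_zero norm_ge_zero, of "cinner e f" "cinner e (Y f)"]
      by (simp only: mult.assoc)
    then have "\<mu> f * (cmod (cinner f e) * cmod (cinner e (Y f)))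
        \<le> \<mu> f * ((cmod (cinner e f))\<^sup>2 + (cmod (cinner e (Y f)))\<^sup>2)"
      by (rule mult_left_mono) (rule eigenvalue_nonneg[OF fe(2)])
    then show ?thesis
      using eigenvalue_nonneg[OF fe(2)] by (simp add: fe g_def h_def norm_mult)
  qed
  ultimately have "(\<lambda>p. norm (g p)) summable_on F \<times> E"
    by (rule summable_on_comparison_test) simp_all
  then have "g summable_on F \<times> E" by (simp only: summable_on_iff_abs_summable_on_complex)
  then obtain S where S: "(g has_sum S) (F \<times> E)" by (auto simp: summable_on_def)
  have "((\<lambda>f. complex_of_real (\<mu> f) * cinner f (Y f)) has_sum S) F"
    by (rule has_sum_SigmaD[OF S])
      (simp add: g_def, intro has_sum_cmult_right Parseval_cinner E)
  \<comment> \<open>In the other order of summation, the inner sum is the expansion of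
    \<open>e\<close> in the eigenbasis, pushed through \<open>Y\<close> and
    \<open>\<rho>\<close>.\<close>
  moreover have "((\<lambda>e. cinner e (Y (\<rho> e))) has_sum S) E"
  proof (rule has_sum_SigmaD)
    show "((\<lambda>(e, f). g (f, e)) has_sum S) (E \<times> F)"
      using S by (subst has_sum_swap) simp
    fix e assume "e \<in> E"
    have "bounded_linear \<rho>" using positive_op_bounded[OF positive] by (simp add: bounded_clinear_def)
    then have "bounded_linear (\<lambda>x. cinner e (Y (\<rho> x)))"
      by (intro bounded_linear_compose[OF bounded_linear_cinner_right]
          bounded_linear_compose[OF bl])
    from has_sum_bounded_linear[OF this has_sum_onb[OF onb, of e]]
    show "((\<lambda>f. case (e, f) of (e, f) \<Rightarrow> g (f, e)) has_sum cinner e (Y (\<rho> e))) F"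
    proof (rule has_sum_cong[THEN iffD1, rotated])
      fix f assume f: "f \<in> F"
      show "cinner e (Y (\<rho> (cinner f e *\<^sub>C f))) = (case (e, f) of (e, f) \<Rightarrow> g (f, e))"
        by (simp add: bounded_clinear_scaleC[OF positive_op_bounded[OF positive]] eigenvector[OF f]
            bounded_clinear_scaleC[OF Y] scaleR_scaleC[where 'a='a] cinner_scaleC_right g_def)
    qed
  qed
  ultimately show ?thesis by blast
qed

text \<open>The previous lemma holds for every orthonormal basis, in particular for the one selected
  by \<open>SOME\<close> in \<open>trace_op\<close>. All later computations use this eigenbasis
  series.\<close>

lemma expectation_has_sum:
  assumes "bounded_clinear Y"
  shows "((\<lambda>f. complex_of_real (\<mu> f) * cinner f (Y f)) has_sum expectation \<rho> Y) F"
proof -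
  have "is_onb (SOME E :: 'a set. is_onb E)" using ex_is_onb by (rule someI_ex)
  then show ?thesis
    using ex_trace_has_sum[OF assms] infsumI unfolding expectation_def trace_op_def o_def by blast
qed

lemma expectation_ident: "expectation \<rho> (\<lambda>x. x) = 1"
  by (simp add: expectation_def o_def trace_one)

section \<open>Linearity, adjoints and positivity of the expectation\<close>

lemma expectation_add:
  assumes "bounded_clinear X" "bounded_clinear Y"
  shows "expectation \<rho> (\<lambda>x. X x + Y x) = expectation \<rho> X + expectation \<rho> Y"
  using has_sum_add[OF expectation_has_sum[OF assms(1)] expectation_has_sum[OF assms(2)]]
  by (intro has_sum_unique[OF expectation_has_sum[OF bounded_clinear_linear_combinations(3)[OF assms]]])
    (simp add: cinner_add_right distrib_left)

lemma expectation_scaleC: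
  assumes "bounded_clinear X"
  shows "expectation \<rho> (\<lambda>x. c *\<^sub>C X x) = c * expectation \<rho> X"
  using has_sum_cmult_right[OF expectation_has_sum[OF assms(1)], of c]
  by (intro has_sum_unique[OF expectation_has_sum[OF bounded_clinear_linear_combinations(5)[OF assms]]])
    (simp add: cinner_scaleC_right mult.left_commute)

lemma expectation_scaleC_ident: "expectation \<rho> (\<lambda>x. c *\<^sub>C x) = c"
  using expectation_scaleC[of "\<lambda>x. x"]
  by (simp add: bounded_clinear_linear_combinations(1) expectation_ident)

lemma expectation_diff:
  assumes "bounded_clinear X" "bounded_clinear Y"
  shows "expectation \<rho> (\<lambda>x. X x - Y x) = expectation \<rho> X - expectation \<rho> Y"
  using expectation_add[OF bounded_clinear_linear_combinations(4)[OF assms] assms(2)] by simp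

text \<open>The weights \<open>\<mu> f\<close> are real, so the series can be conjugated term by
  term. Self-adjoint operators thus have real expectations, and reversing a product of observables
  conjugates its expectation.\<close>

lemma expectation_adjoint:
  assumes X: "bounded_clinear X" "bounded_clinear X'"
    and adj: "\<And>x y. cinner (X x) y = cinner x (X' y)"
  shows "expectation \<rho> X' = cnj (expectation \<rho> X)"
proof (rule has_sum_unique[OF expectation_has_sum[OF X(2)]])
  have "((\<lambda>f. cnj (complex_of_real (\<mu> f) * cinner f (X f))) has_sum cnj (expectation \<rho> X)) F"
    using expectation_has_sum[OF X(1)] by (simp only: has_sum_cnj_iff)
  moreover have "cnj (cinner f (X f)) = cinner f (X' f)" for f
    by (simp add: adj flip: cinner_commute)
  ultimately show "((\<lambda>f. complex_of_real (\<mu> f) * cinner f (X' f)) has_sum cnj (expectation \<rho> X)) F"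
    by simp
qed

lemma expectation_square_has_sum:
  assumes X: "bounded_clinear X" "bounded_clinear X'"
    and adj: "\<And>x y. cinner (X x) y = cinner x (X' y)"
  shows "((\<lambda>f. \<mu> f * (norm (X f))\<^sup>2) has_sum Re (expectation \<rho> (\<lambda>x. X' (X x)))) F"
  using has_sum_Re[OF expectation_has_sum[OF bounded_clinear_compose[OF X(2,1)]]]
  by (simp add: cinner_self flip: adj of_real_power of_real_mult)

lemma expectation_square_nonneg:
  assumes "bounded_clinear X" "bounded_clinear X'" "\<And>x y. cinner (X x) y = cinner x (X' y)"
  shows "0 \<le> Re (expectation \<rho> (\<lambda>x. X' (X x)))"
  by (rule has_sum_nonneg[OF expectation_square_has_sum[OF assms]]) (simp add: eigenvalue_nonneg)

text \<open>
  The hypothesis on \<open>r\<close> says that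
  \<open>(X, Y) \<mapsto> (1 + r) / 2 * expectation (X* Y) + (1 - r) / 2 * expectation (Y X*)\<close> is positive
  semidefinite; the conclusion is its Cauchy--Schwarz inequality at the centred observables.
\<close>

lemma uncertainty_from_positivity:
  assumes pos: "\<And>X X'. bounded_clinear X \<Longrightarrow> bounded_clinear X' \<Longrightarrow>
      (\<And>x y. cinner (X x) y = cinner x (X' y)) \<Longrightarrow>
      0 \<le> (1 + r) * Re (expectation \<rho> (\<lambda>x. X' (X x))) + (1 - r) * Re (expectation \<rho> (\<lambda>x. X (X' x)))"
    and A: "observable A" and B: "observable B"
  shows "r\<^sup>2 / 4 * (cmod (expectation \<rho> (commutator A B)))\<^sup>2 + (covariance \<rho> A B)\<^sup>2
    \<le> variance \<rho> A * variance \<rho> B"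
proof -
  note bounded_clinear_linear_combinations [simp]
  define a b where "a = expectation \<rho> A" and "b = expectation \<rho> B"
  define A0 B0 where "A0 = (\<lambda>x. A x - a *\<^sub>C x)" and "B0 = (\<lambda>x. B x - b *\<^sub>C x)"
  have cA [simp]: "bounded_clinear A" and sA: "cinner (A x) y = cinner x (A y)" for x y
    using A by (auto simp: observable_def)
  have cB [simp]: "bounded_clinear B" and sB: "cinner (B x) y = cinner x (B y)" for x y
    using B by (auto simp: observable_def)
  have cA0 [simp]: "bounded_clinear A0" unfolding A0_def by simp
  have cB0 [simp]: "bounded_clinear B0" unfolding B0_def by simp
  note [simp] = bounded_clinear_compose[OF cA cB] bounded_clinear_compose[OF cB cA]
    bounded_clinear_compose[OF cA0 cA0] bounded_clinear_compose[OF cA0 cB0]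
    bounded_clinear_compose[OF cB0 cA0] bounded_clinear_compose[OF cB0 cB0]
  have a_real: "cnj a = a" and b_real: "cnj b = b"
    using expectation_adjoint[OF cA cA sA] expectation_adjoint[OF cB cB sB]
    by (simp_all add: a_def b_def)
  have sA0: "cinner (A0 x) y = cinner x (A0 y)" for x y
    by (simp add: A0_def cinner_diff_left cinner_diff_right cinner_scaleC_left cinner_scaleC_right
        sA a_real)
  have sB0: "cinner (B0 x) y = cinner x (B0 y)" for x y
    by (simp add: B0_def cinner_diff_left cinner_diff_right cinner_scaleC_left cinner_scaleC_right
        sB b_real)
  define p where "p = expectation \<rho> (\<lambda>x. A0 (B0 x))"
  have p': "expectation \<rho> (\<lambda>x. B0 (A0 x)) = cnj p"
    unfolding p_def by (rule expectation_adjoint) (simp_all add: sA0 sB0)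
  define u w where "u = variance \<rho> A" and "w = variance \<rho> B"
  have u: "expectation \<rho> (\<lambda>x. A0 (A0 x)) = complex_of_real u"
  proof -
    have "expectation \<rho> (\<lambda>x. A0 (A0 x)) = cnj (expectation \<rho> (\<lambda>x. A0 (A0 x)))"
      by (rule expectation_adjoint) (simp_all add: sA0)
    then show ?thesis
      by (simp add: u_def variance_def Let_def o_def A0_def a_def complex_eq_iff)
  qed
  have w: "expectation \<rho> (\<lambda>x. B0 (B0 x)) = complex_of_real w"
  proof -
    have "expectation \<rho> (\<lambda>x. B0 (B0 x)) = cnj (expectation \<rho> (\<lambda>x. B0 (B0 x)))"
      by (rule expectation_adjoint) (simp_all add: sB0)
    then show ?thesis
      by (simp add: w_def variance_def Let_def o_def B0_def b_def complex_eq_iff)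
  qed
  \<comment> \<open>Undoing the centring: the two mixed terms contribute \<open>a * b\<close> each
    and the constant term removes one of them.\<close>
  have AB: "expectation \<rho> (\<lambda>x. A (B x)) = p + a * b"
  proof -
    have "A (B x) = A0 (B0 x) + (b *\<^sub>C A x + (a *\<^sub>C B x - (a * b) *\<^sub>C x))" for x
      by (simp add: A0_def B0_def bounded_clinear_diff[OF cA] bounded_clinear_scaleC[OF cA]
          complex_vector.scale_right_diff_distrib scaleC_scaleC)
    then show ?thesis
      by (simp add: expectation_add expectation_diff expectation_scaleC expectation_scaleC_ident p_def
          flip: a_def b_def)
  qed
  have "expectation \<rho> (\<lambda>x. B (A x)) = cnj (expectation \<rho> (\<lambda>x. A (B x)))"
    by (rule expectation_adjoint) (simp_all add: sA sB)
  then have BA: "expectation \<rho> (\<lambda>x. B (A x)) = cnj p + a * b"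
    by (simp add: AB a_real b_real)
  have comm: "expectation \<rho> (commutator A B) = p - cnj p"
    by (simp add: commutator_def expectation_diff AB BA)
  have cov: "covariance \<rho> A B = Re p"
    using a_real b_real
    by (simp add: covariance_def anticommutator_def expectation_add AB BA complex_eq_iff
        add_divide_distrib flip: a_def b_def)
  have quad: "0 \<le> x\<^sup>2 * u + 2 * x * (\<alpha> * Re p - r * (\<beta> * Im p)) + (\<alpha>\<^sup>2 + \<beta>\<^sup>2) * w" for x \<alpha> \<beta> :: real
  proof -
    \<comment> \<open>This is the expectation of X* X for \<open>X = x A0 + z B0\<close>. Replacing
      \<open>z\<close> by \<open>cnj z\<close> exchanges \<open>X\<close> and its adjoint, so one
      formula covers both terms of the positivity hypothesis.\<close>
    have E: "expectation \<rho> (\<lambda>v. (complex_of_real x *\<^sub>C A0 (complex_of_real x *\<^sub>C A0 v + z *\<^sub>C B0 v)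
          + cnj z *\<^sub>C B0 (complex_of_real x *\<^sub>C A0 v + z *\<^sub>C B0 v)))
        = complex_of_real (x\<^sup>2 * u + 2 * x * Re (z * p) + (cmod z)\<^sup>2 * w)" for z
    proof -
      have "(\<lambda>v. (complex_of_real x *\<^sub>C A0 (complex_of_real x *\<^sub>C A0 v + z *\<^sub>C B0 v)
          + cnj z *\<^sub>C B0 (complex_of_real x *\<^sub>C A0 v + z *\<^sub>C B0 v)))
        = (\<lambda>v. (complex_of_real x * complex_of_real x) *\<^sub>C A0 (A0 v)
            + ((complex_of_real x * z) *\<^sub>C A0 (B0 v)
            + ((cnj z * complex_of_real x) *\<^sub>C B0 (A0 v) + (cnj z * z) *\<^sub>C B0 (B0 v))))"
        by (simp add: bounded_clinear_add[OF cA0] bounded_clinear_scaleC[OF cA0]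
            bounded_clinear_add[OF cB0] bounded_clinear_scaleC[OF cB0]
            scaleC_add_right scaleC_scaleC add.assoc)
      then have "expectation \<rho> (\<lambda>v. (complex_of_real x *\<^sub>C A0 (complex_of_real x *\<^sub>C A0 v + z *\<^sub>C B0 v)
          + cnj z *\<^sub>C B0 (complex_of_real x *\<^sub>C A0 v + z *\<^sub>C B0 v)))
        = (complex_of_real x * complex_of_real x) * complex_of_real u
          + ((complex_of_real x * z) * p + ((cnj z * complex_of_real x) * cnj p
          + (cnj z * z) * complex_of_real w))"
        by (simp add: expectation_add expectation_scaleC u w p' flip: p_def)
      also have "\<dots> = complex_of_real (x\<^sup>2 * u + 2 * x * Re (z * p) + (cmod z)\<^sup>2 * w)"
        unfolding cmod_power2 by (simp add: complex_eq_iff power2_eq_square algebra_simps)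
      finally show ?thesis .
    qed
    define z where "z = Complex \<alpha> \<beta>"
    have "0 \<le> (1 + r) * (x\<^sup>2 * u + 2 * x * Re (z * p) + (cmod z)\<^sup>2 * w)
        + (1 - r) * (x\<^sup>2 * u + 2 * x * Re (cnj z * p) + (cmod z)\<^sup>2 * w)"
      using pos[of "\<lambda>v. complex_of_real x *\<^sub>C A0 v + z *\<^sub>C B0 v"
          "\<lambda>v. complex_of_real x *\<^sub>C A0 v + cnj z *\<^sub>C B0 v"] E[of z] E[of "cnj z"]
      by (simp add: cinner_add_left cinner_add_right cinner_scaleC_left cinner_scaleC_right sA0 sB0)
    also have "\<dots> = 2 * (x\<^sup>2 * u + 2 * x * (\<alpha> * Re p - r * (\<beta> * Im p)) + (\<alpha>\<^sup>2 + \<beta>\<^sup>2) * w)"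
      unfolding cmod_power2 by (simp add: z_def algebra_simps)
    finally show ?thesis by simp
  qed
  define n where "n = (Re p)\<^sup>2 + (r * Im p)\<^sup>2"
  \<comment> \<open>The choice \<open>\<alpha> = Re p\<close>, \<open>\<beta> = - r * Im p\<close>
    makes the cross term and the squared modulus of the coefficient both equal to \<open>n\<close>;
    what remains is a quadratic in the real variable \<open>x\<close>.\<close>
  have n: "0 \<le> x\<^sup>2 * u + 2 * x * n + n * w" for x
    using quad[of x "Re p" "- r * Im p"] by (simp add: n_def power2_eq_square algebra_simps)
  have u0: "0 \<le> u"
    using expectation_square_nonneg[OF cA0 cA0 sA0] u by simp
  have n0: "0 \<le> n" by (simp add: n_def)
  have w0: "0 \<le> w"
    using expectation_square_nonneg[OF cB0 cB0 sB0] w by simp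
  have "n \<le> u * w"
  proof (cases "u = 0")
    case True
    \<comment> \<open>With \<open>u = 0\<close> the quadratic is affine; at this \<open>x\<close> it
      equals \<open>- n * (w + 2)\<close>, which forces \<open>n = 0\<close>.\<close>
    have "0 \<le> 2 * (- (w + 1)) * n + n * w" using n[of "- (w + 1)"] True by simp
    then have "n * (w + 2) \<le> 0" by (simp add: algebra_simps)
    then show ?thesis using n0 w0 True by (simp add: mult_le_0_iff)
  next
    case False
    with u0 have "u > 0" by simp
    \<comment> \<open>The minimizer of the quadratic is \<open>x = - n / u\<close>.\<close>
    have "0 \<le> (- n / u)\<^sup>2 * u + 2 * (- n / u) * n + n * w" by (rule n)
    also have "\<dots> = n * (u * w - n) / u" using \<open>u > 0\<close> by (simp add: field_simps power2_eq_square)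
    finally have "0 \<le> n * (u * w - n)" using \<open>u > 0\<close> by (simp add: zero_le_divide_iff)
    then show ?thesis using n0 u0 w0 by (cases "n = 0") (auto simp: zero_le_mult_iff)
  qed
  moreover have "r\<^sup>2 / 4 * (cmod (p - cnj p))\<^sup>2 + (Re p)\<^sup>2 = n"
    unfolding cmod_power2 by (simp add: n_def power2_eq_square)
  ultimately show ?thesis by (simp add: comm cov u_def w_def)
qed

end

section \<open>Extreme eigenvalues\<close>

context diagonalized_state
begin

section \<open>Dimension and eigenvalues in terms of the eigenbasis\<close>

text \<open>Orthonormal vectors are independent, so a finite spanning set bounds \<open>F\<close>;
  conversely a finite \<open>F\<close> spans by the basis expansion. This resolves the case
  distinction in \<open>lambda_min\<close>.\<close>

lemma finite_dimensional_iff_finite: "finite_dimensional TYPE('a) \<longleftrightarrow> finite F"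
proof
  from onb have on: "orthonormal F" by (simp add: is_onb_def)
  assume "finite_dimensional TYPE('a)"
  then obtain B :: "'a set" where B: "finite B" "complex_vector.span B = UNIV"
    by (auto simp: finite_dimensional_def)
  have "complex_vector.independent F"
    unfolding complex_vector.dependent_explicit
  proof (safe)
    fix G c v assume G: "finite G" "G \<subseteq> F" "(\<Sum>e\<in>G. c e *\<^sub>C e) = 0" "v \<in> G" "c v \<noteq> 0"
    then have "(\<Sum>e\<in>G. (cmod (c e))\<^sup>2) = 0"
      using norm_sum_orthonormal[OF on G(1,2), of c] by simp
    then show False using G by (simp add: sum_nonneg_eq_0_iff)
  qed
  then show "finite F"
    using complex_vector.independent_span_bound[OF B(1)] B(2) by blast
next
  assume fin: "finite F"
  have "x \<in> complex_vector.span F" for x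
  proof -
    have "x = (\<Sum>f\<in>F. cinner f x *\<^sub>C f)"
      using has_sum_onb[OF onb, of x] has_sum_finite[OF fin] by (rule has_sum_unique)
    also have "\<dots> \<in> complex_vector.span F"
      by (intro complex_vector.span_sum complex_vector.span_scale complex_vector.span_base)
    finally show ?thesis .
  qed
  then show "finite_dimensional TYPE('a)" using fin by (auto simp: finite_dimensional_def)
qed

text \<open>An eigenvector has a nonzero coefficient at some \<open>f\<close> in \<open>F\<close>;
  self-adjointness then equates its eigenvalue with \<open>\<mu> f\<close>.\<close>

lemma eigenvalue_iff: "eigenvalue \<rho> (complex_of_real l) \<longleftrightarrow> l \<in> \<mu> ` F"
proof
  assume "eigenvalue \<rho> (complex_of_real l)"
  then obtain v where v: "v \<noteq> 0" "\<rho> v = complex_of_real l *\<^sub>C v" by (auto simp: eigenvalue_def)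
  then obtain f where f: "f \<in> F" "cinner f v \<noteq> 0" using onb by (auto simp: is_onb_def)
  have "complex_of_real l * cinner f v = cinner (\<rho> f) v"
    by (simp add: positive_op_selfadjoint[OF positive] v cinner_scaleC_right)
  also have "\<dots> = complex_of_real (\<mu> f) * cinner f v"
    by (simp add: eigenvector[OF f(1)] scaleR_scaleC cinner_scaleC_left)
  finally show "l \<in> \<mu> ` F" using f by auto
next
  assume "l \<in> \<mu> ` F"
  then obtain f where f: "f \<in> F" "l = \<mu> f" by blast
  moreover have "f \<noteq> 0" using norm_eigenvector[OF f(1)] by auto
  ultimately show "eigenvalue \<rho> (complex_of_real l)"
    unfolding eigenvalue_def using eigenvector[OF f(1)] by (auto simp: scaleR_scaleC)
qed

text \<open>With an empty basis the trace would be 0 instead of 1.\<close>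

lemma basis_nonempty: "F \<noteq> {}"
proof
  assume "F = {}"
  then have "((\<lambda>f. complex_of_real (\<mu> f) * cinner f f) has_sum 0) F" by simp
  then show False
    using expectation_has_sum[OF bounded_clinear_linear_combinations(1)] expectation_ident
      has_sum_unique by fastforce
qed

lemma lambda_max_finite:
  assumes "finite F"
  shows "lambda_max \<rho> = Max (\<mu> ` F)"
  unfolding lambda_max_def eigenvalue_iff
  using assms basis_nonempty by (intro Greatest_equality) auto

lemma lambda_min_finite:
  assumes "finite F"
  shows "lambda_min \<rho> = Min (\<mu> ` F)"
proof -
  have "(LEAST l. l \<in> \<mu> ` F) = Min (\<mu> ` F)"
    using assms basis_nonempty by (intro Least_equality) auto
  then show ?thesis
    using assms by (simp add: lambda_min_def eigenvalue_iff finite_dimensional_iff_finite)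
qed

section \<open>The bottom of the spectrum in infinite dimension\<close>

text \<open>A bounded inverse would keep all eigenvalues above some \<open>1 / K\<close>, which
  infinitely many summable eigenvalues cannot satisfy.\<close>

lemma zero_in_spectrum:
  assumes inf: "infinite F"
  shows "0 \<in> op_spectrum \<rho>"
proof (rule ccontr)
  assume "0 \<notin> op_spectrum \<rho>"
  then obtain S where S: "bounded_clinear S" "\<And>x. S (\<rho> x) = x"
    by (auto simp: op_spectrum_def)
  have "bounded_linear S" using S(1) by (simp add: bounded_clinear_def)
  then obtain K where K: "K > 0" "\<And>x. norm (S x) \<le> norm x * K"
    using bounded_linear.pos_bounded by metis
  have lower: "1 / K \<le> \<mu> f" if "f \<in> F" for f
  proof -
    have "norm (S (\<rho> f)) \<le> norm (\<rho> f) * K" by (rule K(2))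
    then have "1 \<le> \<mu> f * K"
      using norm_eigenvector[OF that] eigenvalue_nonneg[OF that]
      by (simp add: S(2)) (simp add: eigenvector[OF that])
    then show ?thesis using K(1) by (simp add: field_simps)
  qed
  obtain N :: nat where N: "K * infsum \<mu> F < real N" using reals_Archimedean2 by blast
  obtain G where G: "finite G" "card G = N" "G \<subseteq> F"
    using infinite_arbitrarily_large[OF inf] by blast
  have "real N * (1 / K) \<le> sum \<mu> G"
    using G lower by (intro sum_bounded_below[of G "1 / K" \<mu>, unfolded G(2)]) auto
  also have "\<dots> \<le> infsum \<mu> F"
    using G eigenvalue_nonneg by (intro finite_sum_le_infsum summable) auto
  finally show False using N K(1) by (simp add: field_simps)
qed

text \<open>
  For \<open>a > 0\<close> the equation \<open>\<rho> x + a *\<^sub>R x = y\<close> is solved as a fixed point of the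
  contraction \<open>x \<mapsto> x - t *\<^sub>R (\<rho> x + a *\<^sub>R x - y)\<close> for small \<open>t\<close>.
\<close>

lemma spectrum_nonneg:
  assumes l: "complex_of_real l \<in> op_spectrum \<rho>"
  shows "0 \<le> l"
proof (rule ccontr)
  assume "\<not> 0 \<le> l"
  define a where "a = - l"
  have "a > 0" using \<open>\<not> 0 \<le> l\<close> by (simp add: a_def)
  define T where "T = (\<lambda>x. \<rho> x + a *\<^sub>R x)"
  note b = positive_op_bounded[OF positive]
  have T_eq: "T x = \<rho> x - complex_of_real l *\<^sub>C x" for x
    by (simp add: T_def a_def flip: scaleR_scaleC)
  have cT: "bounded_clinear T"
    unfolding T_eq[abs_def] by (intro bounded_clinear_linear_combinations b)
  have "bounded_linear \<rho>" using b by (simp add: bounded_clinear_def)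
  then obtain L where L: "L > 0" "\<And>x. norm (\<rho> x) \<le> norm x * L"
    using bounded_linear.pos_bounded by metis
  define K where "K = L + a"
  have K: "K > 0" "a < K" using L(1) \<open>a > 0\<close> by (simp_all add: K_def)
  have T_upper: "norm (T x) \<le> K * norm x" for x
    using norm_triangle_ineq[of "\<rho> x" "a *\<^sub>R x"] L(2)[of x] \<open>a > 0\<close>
    by (simp add: T_def K_def algebra_simps)
  have T_lower: "a * (norm x)\<^sup>2 \<le> inner x (T x)" for x
    using positive_op_inner_nonneg[OF positive, of x]
    by (simp add: T_def inner_add_right power2_norm_eq_inner)
  \<comment> \<open>Coercivity of \<open>T\<close> gives injectivity and, later, the bound
    \<open>1 / a\<close> on the inverse.\<close>
  have inv_bound: "norm x \<le> norm (T x) * (1 / a)" for x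
  proof (cases "x = 0")
    case False
    have "norm x * (a * norm x) \<le> norm x * norm (T x)"
      using T_lower[of x] norm_cauchy_schwarz[of x "T x"] by (simp add: power2_eq_square mult_ac)
    then show ?thesis using False \<open>a > 0\<close> by (simp add: field_simps)
  qed (use \<open>a > 0\<close> in simp)
  have inj: "x = y" if "T x = T y" for x y
    using inv_bound[of "x - y"] that by (simp add: bounded_clinear_diff[OF cT])
  have "\<exists>x. T x = y" for y
  proof -
    \<comment> \<open>This \<open>t\<close> minimizes
      \<open>1 - 2 * t * a + t\<^sup>2 * K\<^sup>2\<close>, the bound on the squared contraction
      factor; the minimum is \<open>1 - a\<^sup>2 / K\<^sup>2\<close>.\<close>
    define t where "t = a / K\<^sup>2"
    define c where "c = sqrt (1 - a\<^sup>2 / K\<^sup>2)"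
    have "t > 0" using \<open>a > 0\<close> K by (simp add: t_def)
    have aK: "0 < a\<^sup>2 / K\<^sup>2" "a\<^sup>2 / K\<^sup>2 \<le> 1"
      using \<open>a > 0\<close> K by (simp_all add: divide_le_eq power_mono)
    have contr: "norm (d - t *\<^sub>R T d) \<le> c * norm d" for d
    proof (rule power2_le_imp_le)
      have "(norm (d - t *\<^sub>R T d))\<^sup>2 = (norm d)\<^sup>2 - 2 * t * inner d (T d) + t\<^sup>2 * (norm (T d))\<^sup>2"
        by (simp add: power2_norm_eq_inner inner_diff_left inner_diff_right inner_commute
            power2_eq_square[of t] algebra_simps)
      also have "\<dots> \<le> (norm d)\<^sup>2 - 2 * t * (a * (norm d)\<^sup>2) + t\<^sup>2 * (K * norm d)\<^sup>2"
        using \<open>t > 0\<close>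
        by (intro add_mono diff_mono mult_left_mono power_mono T_upper T_lower) simp_all
      also have "\<dots> = (1 - a\<^sup>2 / K\<^sup>2) * (norm d)\<^sup>2"
        using K by (simp add: t_def field_simps power2_eq_square)
      also have "\<dots> = (c * norm d)\<^sup>2" using aK by (simp add: c_def power_mult_distrib)
      finally show "(norm (d - t *\<^sub>R T d))\<^sup>2 \<le> (c * norm d)\<^sup>2" .
      show "0 \<le> c * norm d" using aK by (simp add: c_def)
    qed
    have "\<exists>!x. x - t *\<^sub>R (T x - y) = x"
    proof (rule banach_fix_type)
      show "0 \<le> c" "c < 1" using aK by (simp_all add: c_def)
      show "\<forall>x x'. dist (x - t *\<^sub>R (T x - y)) (x' - t *\<^sub>R (T x' - y)) \<le> c * dist x x'"
      proof (intro allI)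
        fix x x'
        have "x - t *\<^sub>R (T x - y) - (x' - t *\<^sub>R (T x' - y)) = (x - x') - t *\<^sub>R T (x - x')"
          by (simp add: bounded_clinear_diff[OF cT] algebra_simps)
        then show "dist (x - t *\<^sub>R (T x - y)) (x' - t *\<^sub>R (T x' - y)) \<le> c * dist x x'"
          using contr[of "x - x'"] by (simp only: dist_norm)
      qed
    qed
    then obtain x where "x - t *\<^sub>R (T x - y) = x" by blast
    then have "T x = y" using \<open>t > 0\<close> by simp
    then show ?thesis ..
  qed
  then obtain S where S: "\<And>y. T (S y) = y" by metis
  have ST: "S (T x) = x" for x by (rule inj) (rule S)
  have "bounded_linear S"
  proof (rule bounded_linear_intro)
    show "S (x + y) = S x + S y" for x y
      by (rule inj) (simp add: S bounded_clinear_add[OF cT])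
    show "S (r *\<^sub>R x) = r *\<^sub>R S x" for r x
      by (rule inj) (simp add: S bounded_clinear_scaleR[OF cT])
    show "norm (S x) \<le> norm x * (1 / a)" for x
      using inv_bound[of "S x"] by (simp add: S)
  qed
  moreover have "S (c *\<^sub>C x) = c *\<^sub>C S x" for c x
    by (rule inj) (simp add: S bounded_clinear_scaleC[OF cT])
  ultimately have "bounded_clinear S" by (simp add: bounded_clinear_def)
  then show False using l S ST by (auto simp: op_spectrum_def T_eq)
qed

lemma lambda_min_infinite:
  assumes "infinite F"
  shows "lambda_min \<rho> = 0"
proof -
  have "Inf {l. complex_of_real l \<in> op_spectrum \<rho>} = 0"
    using zero_in_spectrum[OF assms] by (intro cInf_eq_minimum) (simp_all add: spectrum_nonneg)
  then show ?thesis
    using assms by (simp add: lambda_min_def finite_dimensional_iff_finite)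
qed

section \<open>Positivity of the weighted form\<close>

text \<open>This supplies the hypothesis of \<open>uncertainty_from_positivity\<close>. The weight
  \<open>1 - r\<close> can be negative, so nonnegativity of the two expectations does not suffice
  and they have to be compared through the extreme eigenvalues.\<close>

lemma extreme_eigenvalue_positivity:
  defines "r \<equiv> (lambda_max \<rho> + lambda_min \<rho>) / (lambda_max \<rho> - lambda_min \<rho>)"
  assumes X: "bounded_clinear X" "bounded_clinear X'"
    and adj: "\<And>x y. cinner (X x) y = cinner x (X' y)"
  shows "0 \<le> (1 + r) * Re (expectation \<rho> (\<lambda>x. X' (X x))) + (1 - r) * Re (expectation \<rho> (\<lambda>x. X (X' x)))"
proof -
  have adj': "cinner (X' x) y = cinner x (X y)" for x y
    by (metis adj cinner_commute)
  let ?p = "Re (expectation \<rho> (\<lambda>x. X' (X x)))" and ?q = "Re (expectation \<rho> (\<lambda>x. X (X' x)))"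
  have p0: "0 \<le> ?p" and q0: "0 \<le> ?q"
    using expectation_square_nonneg[OF X adj] expectation_square_nonneg[OF X(2,1) adj'] by auto
  define M m where "M = lambda_max \<rho>" and "m = lambda_min \<rho>"
  have r: "r = (M + m) / (M - m)" by (simp add: r_def M_def m_def)
  \<comment> \<open>Equal extremes give \<open>r = 0\<close> by the convention for division by zero.
    For infinite \<open>F\<close>, \<open>m = 0\<close> gives \<open>r = M / M\<close>, which is 1
    when \<open>M\<close> differs from \<open>m\<close>. In both cases the weights are
    nonnegative.\<close>
  consider "r = 0" | "r = 1" | "finite F" "M \<noteq> m"
    using lambda_min_infinite by (cases "finite F"; cases "M = m") (auto simp: r m_def)
  then show ?thesis
  proof cases
    case 3
    have m_le: "m \<le> \<mu> f" and le_M: "\<mu> f \<le> M" if "f \<in> F" for f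
      using that 3(1) by (auto simp: m_def M_def lambda_min_finite lambda_max_finite)
    have "m \<in> \<mu> ` F"
      unfolding m_def lambda_min_finite[OF 3(1)] using 3(1) basis_nonempty by (intro Min_in) auto
    then have m0: "0 \<le> m" "m \<le> M" using eigenvalue_nonneg le_M by auto
    with 3(2) have "M - m > 0" by simp
    \<comment> \<open>\<open>N\<close> is the squared Hilbert-Schmidt norm of \<open>X\<close>.
      Expanding by Parseval and exchanging the two finite sums shows that the adjoint has the same
      norm, which links \<open>?p\<close> and \<open>?q\<close>.\<close>
    define N where "N = (\<Sum>f\<in>F. (norm (X f))\<^sup>2)"
    have norm_eq: "(norm x)\<^sup>2 = (\<Sum>g\<in>F. (cmod (cinner g x))\<^sup>2)" for x
      using Parseval_norm[OF onb, of x] has_sum_finite[OF 3(1)] by (rule has_sum_unique)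
    have "N = (\<Sum>f\<in>F. \<Sum>g\<in>F. (cmod (cinner g (X f)))\<^sup>2)" by (simp add: N_def norm_eq[of "X _"])
    also have "\<dots> = (\<Sum>f\<in>F. \<Sum>g\<in>F. (cmod (cinner f (X' g)))\<^sup>2)"
      by (intro sum.cong refl) (metis adj cinner_commute complex_mod_cnj)
    also have "\<dots> = (\<Sum>g\<in>F. (norm (X' g))\<^sup>2)" by (subst sum.swap) (simp add: norm_eq[of "X' _"])
    finally have N': "N = (\<Sum>g\<in>F. (norm (X' g))\<^sup>2)" .
    have "?p = (\<Sum>f\<in>F. \<mu> f * (norm (X f))\<^sup>2)"
      using expectation_square_has_sum[OF X adj] has_sum_finite[OF 3(1)] by (rule has_sum_unique)
    also have "\<dots> \<ge> m * N"
      unfolding N_def sum_distrib_left by (intro sum_mono mult_right_mono m_le) simp_all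
    finally have p: "m * N \<le> ?p" .
    have "?q = (\<Sum>f\<in>F. \<mu> f * (norm (X' f))\<^sup>2)"
      using expectation_square_has_sum[OF X(2,1) adj'] has_sum_finite[OF 3(1)] by (rule has_sum_unique)
    also have "\<dots> \<le> M * N"
      unfolding N' sum_distrib_left by (intro sum_mono mult_right_mono le_M) simp_all
    finally have q: "?q \<le> M * N" .
    \<comment> \<open>Both sides are compared with \<open>M * m * N\<close>, from the upper bound on
      \<open>?q\<close> and the lower bound on \<open>?p\<close>.\<close>
    have "m * ?q \<le> m * (M * N)" using q m0 by (intro mult_left_mono)
    also have "\<dots> = M * (m * N)" by simp
    also have "\<dots> \<le> M * ?p" using p m0 by (intro mult_left_mono) simp_all
    finally have "0 \<le> (2 * (M * ?p - m * ?q)) / (M - m)" using \<open>M - m > 0\<close> by simp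
    also have "\<dots> = (2 * M / (M - m)) * ?p + (- 2 * m / (M - m)) * ?q"
      by (simp add: diff_divide_distrib right_diff_distrib)
    also have "2 * M / (M - m) = 1 + r"
      using \<open>M - m > 0\<close> by (simp add: r field_simps)
    also have "- 2 * m / (M - m) = 1 - r"
      using \<open>M - m > 0\<close> by (simp add: r field_simps)
    finally show ?thesis .
  qed (use p0 q0 in simp_all)
qed

end

theorem theorem2:
  fixes \<rho> A B :: "'a::chilbert_space \<Rightarrow> 'a"
  assumes "separable_space (euclidean :: 'a topology)"
    and "quantum_state \<rho>"
    and "\<not> maximally_mixed \<rho>"
    and "observable A"
    and "observable B"
  shows "variance \<rho> A * variance \<rho> B \<ge>
    (lambda_max \<rho> + lambda_min \<rho>)\<^sup>2 / (4 * (lambda_max \<rho> - lambda_min \<rho>)\<^sup>2)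
      * (cmod (expectation \<rho> (commutator A B)))\<^sup>2 + (covariance \<rho> A B)\<^sup>2"
proof -
  have \<rho>: "positive_op \<rho>" "trace_class \<rho>" "trace_op \<rho> = 1"
    using assms(2) by (simp_all add: quantum_state_def)
  obtain F \<mu> where F: "is_onb F" "\<And>f. f \<in> F \<Longrightarrow> 0 \<le> \<mu> f" "\<And>f. f \<in> F \<Longrightarrow> \<rho> f = \<mu> f *\<^sub>R f"
    "\<mu> summable_on F"
    using trace_class_eigenbasis[OF \<rho>(1,2)] by metis
  interpret diagonalized_state \<rho> F \<mu>
    by (rule diagonalized_state.intro) (fact \<rho> F)+
  define r where "r = (lambda_max \<rho> + lambda_min \<rho>) / (lambda_max \<rho> - lambda_min \<rho>)"
  have "r\<^sup>2 / 4 * (cmod (expectation \<rho> (commutator A B)))\<^sup>2 + (covariance \<rho> A B)\<^sup>2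
    \<le> variance \<rho> A * variance \<rho> B"
  proof (rule uncertainty_from_positivity[OF _ assms(4,5)])
    fix X X' :: "'a \<Rightarrow> 'a"
    assume "bounded_clinear X" "bounded_clinear X'" "\<And>x y. cinner (X x) y = cinner x (X' y)"
    then show "0 \<le> (1 + r) * Re (expectation \<rho> (\<lambda>x. X' (X x)))
        + (1 - r) * Re (expectation \<rho> (\<lambda>x. X (X' x)))"
      unfolding r_def by (rule extreme_eigenvalue_positivity[of X X'])
  qed
  then show ?thesis by (simp add: r_def power_divide mult.commute)
qed

end
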